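(* Let $(c_j)_{j\geqslant 0}$ be a decreasing sequence of positive numbers. Then there exist a probability space $(\Omega,\mathcal F,\mu)$, a one-to-one, bi-measurable, measure preserving map $T\colon\Omega\to\Omega$ and a zero mean square integrable measurable function $f\colon\Omega\to\mathbb R$ such that the strictly stationary process $Y=(Y_k)=(f\circ T^k)$ satisfies all of the following conditions: (a) the central limit theorem with normalization $\sqrt n$ holds for $Y$; (b) the weak invariance principle with normalization $\sqrt n$ does not hold for $Y$, neither in $C[0,1]$ nor in $D[0,1]$; (c) $\sigma_N(f)^2\asymp N$; (d') there is an increasing sequence $(m_k)_{k\geqslant 1}$ of integers such that for each $k$, $\beta_Y(m_k)\leqslant c_{m_k}$; (e) $Y_0\in\mathbb L^p$ for every $p>0$.
   Context: For a zero mean square integrable $f\colon\Omega\to\mathbb R$: $S_n(f):=\sum_{j=0}^{n-1}f\circ T^j$, $\sigma_n^2(f):=\mathbb E(S_n(f)^2)$, and for $t\in[0,1]$, $S_n^*(f,t):=S_{\lfloor nt\rfloor}(f)+(nt-\lfloor nt\rfloor)f\circ T^{\lfloor nt\rfloor}$ and $S_n^{**}(f,t):=S_{\lfloor nt\rfloor}(f)$. The central limit theorem with normalization $a_n$ holds if $a_n^{-1}S_n(f)$ converges weakly to a standard normal distribution. The weak invariance principle in $C[0,1]$ (resp. $D[0,1]$) with normalization $a_n$ holds if the random elements $a_n^{-1}S_n^*(f,\cdot)$ of $C[0,1]$ with the sup norm (resp. $a_n^{-1}S_n^{**}(f,\cdot)$ of $D[0,1]$, the space of càdlàg functions with the Skorohod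 metric) converge weakly to a (standard) Brownian motion process in the corresponding space. For sub-$\sigma$-algebras $\mathcal A,\mathcal B$ of $\mathcal F$, $\beta(\mathcal A,\mathcal B):=\frac12\sup\sum_{i=1}^I\sum_{j=1}^J|\mu(A_i\cap B_j)-\mu(A_i)\mu(B_j)|$, the supremum being over finite partitions $\{A_i\}$, $\{B_j\}$ of $\Omega$ into elements of $\mathcal A$, respectively $\mathcal B$. For a strictly stationary sequence $X=(X_k)_{k\in\mathbb Z}$ and $n\geqslant 0$, $\beta_X(n):=\beta(\sigma(X_k,k\leqslant 0),\sigma(X_k,k\geqslant n))$; here $Y$ is indexed by $\mathbb Z$ via $Y_k=f\circ T^k$. For sequences of positive reals, $a_N\asymp b_N$ means there is $C>0$ with $C^{-1}a_N\leqslant b_N\leqslant Ca_N$ for all $N\geqslant 1$. *)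

theory Defs
  imports "HOL-Probability.Probability"
begin

section \<open>Invertible measure-preserving transformations and partial sums\<close>

definition invertible_mpt :: "'a measure \<Rightarrow> ('a \<Rightarrow> 'a) \<Rightarrow> bool" where
  "invertible_mpt M T \<longleftrightarrow>
     bij_betw T (space M) (space M) \<and>
     T \<in> measurable M M \<and> the_inv_into (space M) T \<in> measurable M M \<and>
     distr M M T = M"

definition int_iterate :: "'a set \<Rightarrow> ('a \<Rightarrow> 'a) \<Rightarrow> int \<Rightarrow> 'a \<Rightarrow> 'a" where
  "int_iterate \<Omega> T k = (if 0 \<le> k then T ^^ nat k else the_inv_into \<Omega> T ^^ nat (- k))"

definition stationary_process :: "'a measure \<Rightarrow> ('a \<Rightarrow> 'a) \<Rightarrow> ('a \<Rightarrow> real) \<Rightarrow> int \<Rightarrow> 'a \<Rightarrow> real" where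
  "stationary_process M T f k = f \<circ> int_iterate (space M) T k"

definition zero_mean_square_integrable :: "'a measure \<Rightarrow> ('a \<Rightarrow> real) \<Rightarrow> bool" where
  "zero_mean_square_integrable M f \<longleftrightarrow>
     f \<in> borel_measurable M \<and> integrable M (\<lambda>\<omega>. (f \<omega>)\<^sup>2) \<and>
     integrable M f \<and> (\<integral>\<omega>. f \<omega> \<partial>M) = 0"

definition psum :: "('a \<Rightarrow> 'a) \<Rightarrow> ('a \<Rightarrow> real) \<Rightarrow> nat \<Rightarrow> 'a \<Rightarrow> real" where
  "psum T f n \<omega> = (\<Sum>j<n. f ((T ^^ j) \<omega>))"

definition psum_variance :: "'a measure \<Rightarrow> ('a \<Rightarrow> 'a) \<Rightarrow> ('a \<Rightarrow> real) \<Rightarrow> nat \<Rightarrow> real" where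
  "psum_variance M T f n = (\<integral>\<omega>. (psum T f n \<omega>)\<^sup>2 \<partial>M)"

definition asymp_equal :: "(nat \<Rightarrow> real) \<Rightarrow> (nat \<Rightarrow> real) \<Rightarrow> bool" where
  "asymp_equal a b \<longleftrightarrow> (\<exists>C>0. \<forall>N\<ge>1. inverse C * a N \<le> b N \<and> b N \<le> C * a N)"


section \<open>Path spaces over the unit interval\<close>

text \<open>Paths are extensional functions on \<open>{0..1}\<close>, so that equality of functions of type
  \<open>real \<Rightarrow> real\<close> is equality of paths.\<close>

definition C01 :: "(real \<Rightarrow> real) metric" where
  "C01 = cfunspace (top_of_set {0..1}) euclidean_metric"

definition cadlag01 :: "(real \<Rightarrow> real) set" where
  "cadlag01 = {x \<in> extensional {0..1}.
     (\<forall>t\<in>{0..<1}. (x \<longlongrightarrow> x t) (at_right t)) \<and>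
     (\<forall>t\<in>{0<..1}. \<exists>l. (x \<longlongrightarrow> l) (at_left t))}"

definition time_changes :: "(real \<Rightarrow> real) set" where
  "time_changes = {r. strict_mono_on {0..1} r \<and> continuous_on {0..1} r \<and> r ` {0..1} = {0..1}}"

definition skorohod_bounds :: "(real \<Rightarrow> real) \<Rightarrow> (real \<Rightarrow> real) \<Rightarrow> real set" where
  "skorohod_bounds x y = {e. 0 < e \<and>
     (\<exists>r\<in>time_changes. \<forall>t\<in>{0..1}. \<bar>r t - t\<bar> \<le> e \<and> \<bar>x t - y (r t)\<bar> \<le> e)}"

text \<open>The value outside the space of cadlag functions is irrelevant; the locale
  \<open>Metric_space\<close> requires nonnegativity and symmetry there as well.\<close>

definition skorohod_dist :: "(real \<Rightarrow> real) \<Rightarrow> (real \<Rightarrow> real) \<Rightarrow> real" where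
  "skorohod_dist x y =
     (if x \<in> cadlag01 \<and> y \<in> cadlag01 then Inf (skorohod_bounds x y) else 0)"

definition D01 :: "(real \<Rightarrow> real) metric" where
  "D01 = metric (cadlag01, skorohod_dist)"

text \<open>The type of metrics only represents genuine metric spaces, so the definition of
  \<^const>\<open>D01\<close> is meaningful only because of the lemma \<open>Metric_space_skorohod\<close> below.\<close>

lemma time_changes_id: "(\<lambda>t. t) \<in> time_changes"
  by (auto simp: time_changes_def strict_mono_on_def)

lemma time_changes_mem: "r \<in> time_changes \<Longrightarrow> t \<in> {0..1} \<Longrightarrow> r t \<in> {0..1}"
  by (auto simp: time_changes_def)

lemma time_changes_comp:
  assumes "r \<in> time_changes" "s \<in> time_changes"
  shows "(\<lambda>t. s (r t)) \<in> time_changes"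
proof -
  have r: "r ` {0..1} = {0..1}" "strict_mono_on {0..1} r" "continuous_on {0..1} r"
    and s: "s ` {0..1} = {0..1}" "strict_mono_on {0..1} s" "continuous_on {0..1} s"
    using assms by (auto simp: time_changes_def)
  have "(\<lambda>t. s (r t)) ` {0..1} = {0..1}"
    using r(1) s(1) by (metis image_image)
  moreover have "strict_mono_on {0..1} (\<lambda>t. s (r t))"
  proof (rule strict_mono_onI)
    fix a b :: real assume ab: "a \<in> {0..1}" "b \<in> {0..1}" "a < b"
    have "r a < r b" by (rule strict_mono_onD[OF r(2) ab])
    moreover have "r a \<in> {0..1}" "r b \<in> {0..1}" using r(1) ab by blast+
    ultimately show "s (r a) < s (r b)" by (intro strict_mono_onD[OF s(2)])
  qed
  moreover have "continuous_on {0..1} (\<lambda>t. s (r t))"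
    using continuous_on_compose2[OF s(3) r(3)] r(1) by auto
  ultimately show ?thesis by (simp add: time_changes_def)
qed

lemma time_changes_inverse:
  assumes "r \<in> time_changes"
  obtains s where "s \<in> time_changes" "\<And>t. t \<in> {0..1} \<Longrightarrow> r (s t) = t" "\<And>t. t \<in> {0..1} \<Longrightarrow> s (r t) = t"
proof -
  have r: "r ` {0..1} = {0..1}" "strict_mono_on {0..1} r" "continuous_on {0..1} r"
    using assms by (auto simp: time_changes_def)
  have inj: "inj_on r {0..1}"
    using r(2) by (rule strict_mono_on_imp_inj_on)
  define s where "s = the_inv_into {0..1} r"
  have sr: "s (r t) = t" if "t \<in> {0..1}" for t
    unfolding s_def using that inj by (simp add: the_inv_into_f_f)
  have rs: "r (s t) = t" if "t \<in> {0..1}" for t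
    unfolding s_def using that inj r(1) by (simp add: f_the_inv_into_f)
  have im: "s ` {0..1} = {0..1}"
    unfolding s_def using inj r(1) the_inv_into_onto by metis
  have "continuous_on (r ` {0..1}) s"
    by (rule continuous_on_inv[OF r(3)]) (use sr in auto)
  then have cont: "continuous_on {0..1} s" using r(1) by simp
  have "strict_mono_on {0..1} s"
  proof (rule strict_mono_onI)
    fix a b :: real assume ab: "a \<in> {0..1}" "b \<in> {0..1}" "a < b"
    have mem: "s a \<in> {0..1}" "s b \<in> {0..1}" using im ab by blast+
    show "s a < s b"
    proof (rule ccontr)
      assume "\<not> s a < s b"
      then consider "s b < s a" | "s a = s b" by linarith
      then have "r (s b) \<le> r (s a)"
        by cases (use r(2) mem in \<open>auto simp: strict_mono_on_def intro: less_imp_le\<close>)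
      then show False using rs ab by simp
    qed
  qed
  then have "s \<in> time_changes" using im cont by (simp add: time_changes_def)
  then show ?thesis using rs sr that by blast
qed

lemma cadlag01_bounded:
  assumes "x \<in> cadlag01"
  obtains B where "\<And>t. t \<in> {0..1} \<Longrightarrow> \<bar>x t\<bar> \<le> B"
proof -
  have right: "(x \<longlongrightarrow> x t) (at_right t)" if "t \<in> {0..<1}" for t
    using assms that by (auto simp: cadlag01_def)
  have left: "\<exists>l. (x \<longlongrightarrow> l) (at_left t)" if "t \<in> {0<..1}" for t
    using assms that by (auto simp: cadlag01_def)
  have local: "\<exists>e>0. \<exists>B. \<forall>u\<in>{0..1}. \<bar>u - t\<bar> < e \<longrightarrow> \<bar>x u\<bar> \<le> B" if t: "t \<in> {0..1}" for t
  proof -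
    have R: "\<exists>e>0. \<exists>B. \<forall>u\<in>{0..1}. t < u \<and> u < t + e \<longrightarrow> \<bar>x u\<bar> \<le> B"
    proof (cases "t < 1")
      case True
      then have "\<forall>\<^sub>F u in at_right t. dist (x u) (x t) < 1"
        using right[of t] t tendstoD[of x "x t" "at_right t" 1] by auto
      then obtain b where "b > t" and b: "\<And>u. t < u \<Longrightarrow> u < b \<Longrightarrow> dist (x u) (x t) < 1"
        by (auto simp: eventually_at_right_field)
      have "\<bar>x u\<bar> \<le> \<bar>x t\<bar> + 1" if "t < u" "u < t + (b - t)" for u
        using b[of u] that by (auto simp: dist_real_def)
      then show ?thesis using \<open>b > t\<close> by (intro exI[of _ "b - t"] conjI exI[of _ "\<bar>x t\<bar> + 1"]) auto
    qed (auto intro!: exI[of _ 1])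
    have L: "\<exists>e>0. \<exists>B. \<forall>u\<in>{0..1}. t - e < u \<and> u < t \<longrightarrow> \<bar>x u\<bar> \<le> B"
    proof (cases "0 < t")
      case True
      then obtain l where "(x \<longlongrightarrow> l) (at_left t)" using left[of t] t by auto
      then have "\<forall>\<^sub>F u in at_left t. dist (x u) l < 1"
        using tendstoD[of x l "at_left t" 1] by auto
      then obtain b where "b < t" and b: "\<And>u. b < u \<Longrightarrow> u < t \<Longrightarrow> dist (x u) l < 1"
        by (auto simp: eventually_at_left_field)
      have "\<bar>x u\<bar> \<le> \<bar>l\<bar> + 1" if "t - (t - b) < u" "u < t" for u
        using b[of u] that by (auto simp: dist_real_def)
      then show ?thesis using \<open>b < t\<close> by (intro exI[of _ "t - b"] conjI exI[of _ "\<bar>l\<bar> + 1"]) auto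
    qed (use t in \<open>auto intro!: exI[of _ 1]\<close>)
    obtain e1 B1 where 1: "e1 > 0" "\<And>u. u \<in> {0..1} \<Longrightarrow> t < u \<Longrightarrow> u < t + e1 \<Longrightarrow> \<bar>x u\<bar> \<le> B1"
      using R by blast
    obtain e2 B2 where 2: "e2 > 0" "\<And>u. u \<in> {0..1} \<Longrightarrow> t - e2 < u \<Longrightarrow> u < t \<Longrightarrow> \<bar>x u\<bar> \<le> B2"
      using L by blast
    have "\<bar>x u\<bar> \<le> max (max B1 B2) \<bar>x t\<bar>" if "u \<in> {0..1}" "\<bar>u - t\<bar> < min e1 e2" for u
    proof -
      consider "u < t" | "u = t" | "t < u" by linarith
      then show ?thesis
        by cases (use that 1(2)[of u] 2(2)[of u] in \<open>auto simp: max_def\<close>)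
    qed
    then show ?thesis using 1(1) 2(1)
      by (intro exI[of _ "min e1 e2"] conjI exI[of _ "max (max B1 B2) \<bar>x t\<bar>"]) auto
  qed
  obtain e B where e: "\<And>t. t \<in> {0..1} \<Longrightarrow> e t > 0"
    and B: "\<And>t u. t \<in> {0..1} \<Longrightarrow> u \<in> {0..1} \<Longrightarrow> \<bar>u - t\<bar> < e t \<Longrightarrow> \<bar>x u\<bar> \<le> B t"
    using local by metis
  have "{0..1::real} \<subseteq> (\<Union>t\<in>{0..1}. ball t (e t))" using e by force
  then obtain F where F: "F \<subseteq> {0..1}" "finite F" "{0..1} \<subseteq> (\<Union>t\<in>F. ball t (e t))"
    using compactE_image[OF compact_Icc, of "{0..1}" "\<lambda>t. ball t (e t)"]
    by (metis open_ball)
  have "\<bar>x u\<bar> \<le> (\<Sum>t\<in>F. \<bar>B t\<bar>)" if u: "u \<in> {0..1}" for u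
  proof -
    obtain t where t: "t \<in> F" "u \<in> ball t (e t)" using F(3) u by blast
    then have "\<bar>x u\<bar> \<le> \<bar>B t\<bar>"
      using B[of t u] F(1) u by (auto simp: dist_real_def abs_minus_commute)
    also have "\<dots> \<le> (\<Sum>t\<in>F. \<bar>B t\<bar>)"
      using F(2) t(1) by (intro member_le_sum) auto
    finally show ?thesis .
  qed
  then show ?thesis using that by blast
qed

lemma skorohod_bounds_nonempty:
  assumes "x \<in> cadlag01" "y \<in> cadlag01"
  shows "skorohod_bounds x y \<noteq> {}"
proof -
  obtain A B where A: "\<And>t. t \<in> {0..1} \<Longrightarrow> \<bar>x t\<bar> \<le> A" and B: "\<And>t. t \<in> {0..1} \<Longrightarrow> \<bar>y t\<bar> \<le> B"
    using cadlag01_bounded assms by metis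
  have "\<bar>x t - y t\<bar> \<le> \<bar>A\<bar> + \<bar>B\<bar> + 1" if "t \<in> {0..1}" for t
    using A[OF that] B[OF that] by linarith
  then have "\<bar>A\<bar> + \<bar>B\<bar> + 1 \<in> skorohod_bounds x y"
    unfolding skorohod_bounds_def using time_changes_id
    by (intro CollectI conjI bexI[of _ "\<lambda>t. t"]) auto
  then show ?thesis by blast
qed

lemma skorohod_bounds_bdd_below: "bdd_below (skorohod_bounds x y)"
  by (rule bdd_belowI[of _ 0]) (auto simp: skorohod_bounds_def)

lemma skorohod_bounds_sym: "skorohod_bounds x y \<subseteq> skorohod_bounds y x"
proof
  fix e assume "e \<in> skorohod_bounds x y"
  then obtain r where e: "0 < e" and r: "r \<in> time_changes"
    and re: "\<And>t. t \<in> {0..1} \<Longrightarrow> \<bar>r t - t\<bar> \<le> e \<and> \<bar>x t - y (r t)\<bar> \<le> e"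
    by (auto simp: skorohod_bounds_def)
  obtain s where s: "s \<in> time_changes" "\<And>t. t \<in> {0..1} \<Longrightarrow> r (s t) = t"
    using time_changes_inverse[OF r] by metis
  have "\<bar>s t - t\<bar> \<le> e \<and> \<bar>y t - x (s t)\<bar> \<le> e" if t: "t \<in> {0..1}" for t
    using re[OF time_changes_mem[OF s(1) t]] s(2)[OF t] by (simp add: abs_minus_commute)
  then show "e \<in> skorohod_bounds y x"
    unfolding skorohod_bounds_def using e s(1) by blast
qed

lemma skorohod_bounds_add:
  assumes "d \<in> skorohod_bounds x y" "e \<in> skorohod_bounds y z"
  shows "d + e \<in> skorohod_bounds x z"
proof -
  obtain r where d: "0 < d" and r: "r \<in> time_changes"
    and rd: "\<And>t. t \<in> {0..1} \<Longrightarrow> \<bar>r t - t\<bar> \<le> d \<and> \<bar>x t - y (r t)\<bar> \<le> d"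
    using assms(1) by (auto simp: skorohod_bounds_def)
  obtain s where e: "0 < e" and s: "s \<in> time_changes"
    and se: "\<And>t. t \<in> {0..1} \<Longrightarrow> \<bar>s t - t\<bar> \<le> e \<and> \<bar>y t - z (s t)\<bar> \<le> e"
    using assms(2) by (auto simp: skorohod_bounds_def)
  have "\<bar>s (r t) - t\<bar> \<le> d + e \<and> \<bar>x t - z (s (r t))\<bar> \<le> d + e" if t: "t \<in> {0..1}" for t
    using rd[OF t] se[OF time_changes_mem[OF r t]] by linarith
  then show ?thesis
    using d e time_changes_comp[OF r s]
    by (auto simp: skorohod_bounds_def intro!: bexI[of _ "\<lambda>t. s (r t)"])
qed

lemma skorohod_dist_zero_imp_eq:
  assumes x: "x \<in> cadlag01" and y: "y \<in> cadlag01" and 0: "skorohod_dist x y = 0"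
  shows "x = y"
proof -
  have approx: "\<exists>v\<in>{0..1}. \<bar>v - u\<bar> \<le> e \<and> \<bar>x v - y u\<bar> \<le> e \<and> (u = 1 \<longrightarrow> v = 1)"
    if u: "u \<in> {0..1}" and e: "e > 0" for u e
  proof -
    have "Inf (skorohod_bounds y x) < e"
    proof -
      have "skorohod_bounds y x = skorohod_bounds x y"
        by (intro subset_antisym skorohod_bounds_sym)
      then show ?thesis using 0 x y e by (simp add: skorohod_dist_def)
    qed
    then obtain d where "d \<in> skorohod_bounds y x" "d < e"
      using cInf_lessD[OF skorohod_bounds_nonempty[OF y x]] by blast
    then obtain r where r: "r \<in> time_changes"
      and rd: "\<And>t. t \<in> {0..1} \<Longrightarrow> \<bar>r t - t\<bar> \<le> d \<and> \<bar>y t - x (r t)\<bar> \<le> d"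
      by (auto simp: skorohod_bounds_def)
    have "r 1 = 1"
    proof -
      obtain a where a: "a \<in> {0..1}" "r a = 1"
      proof -
        have "r ` {0..1} = {0..1}" using r by (simp add: time_changes_def)
        then have "1 \<in> r ` {0..1}" by simp
        then show ?thesis using that by (metis imageE)
      qed
      have "r a \<le> r 1"
      proof (cases "a = 1")
        case False
        then have "a < 1" using a(1) by auto
        moreover have "strict_mono_on {0..1} r" using r by (simp add: time_changes_def)
        ultimately have "r a < r 1" using a(1) by (intro strict_mono_onD[of "{0..1}" r]) auto
        then show ?thesis by simp
      qed simp
      then show ?thesis using a time_changes_mem[OF r, of 1] by auto
    qed
    then show ?thesis
      using rd[OF u] \<open>d < e\<close> time_changes_mem[OF r u]
      by (intro bexI[of _ "r u"]) (auto simp: abs_minus_commute)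
  qed
  have eq: "x t = y t" if t: "t \<in> {0..1}" for t
  proof (cases "t = 1")
    case True
    have "\<bar>x 1 - y 1\<bar> \<le> 0 + e" if "e > 0" for e
      using approx[of 1 e] that by auto
    then have "\<bar>x 1 - y 1\<bar> \<le> 0" by (rule field_le_epsilon)
    then show ?thesis using True by simp
  next
    case False
    then have t': "t \<in> {0..<1}" using t by auto
    have "\<bar>x t - y t\<bar> \<le> 0 + e" if e: "e > 0" for e
    proof -
      have "\<forall>\<^sub>F u in at_right t. dist (x u) (x t) < e / 3"
        using x t' e tendstoD[of x "x t" "at_right t" "e / 3"] by (auto simp: cadlag01_def)
      then obtain b where b: "b > t" "\<And>u. t < u \<Longrightarrow> u < b \<Longrightarrow> dist (x u) (x t) < e / 3"
        by (auto simp: eventually_at_right_field)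
      have "\<forall>\<^sub>F u in at_right t. dist (y u) (y t) < e / 3"
        using y t' e tendstoD[of y "y t" "at_right t" "e / 3"] by (auto simp: cadlag01_def)
      then obtain c where c: "c > t" "\<And>u. t < u \<Longrightarrow> u < c \<Longrightarrow> dist (y u) (y t) < e / 3"
        by (auto simp: eventually_at_right_field)
      define w where "w = min (min b c) 1"
      have w: "t < w" "w \<le> b" "w \<le> c" "w \<le> 1" using b c t' by (auto simp: w_def)
      define u where "u = (t + w) / 2"
      have u: "t < u" "u < w" "u \<in> {0..1}" using w t' by (auto simp: u_def)
      define h where "h = min (e / 3) ((w - t) / 4)"
      have h: "h > 0" "h \<le> e / 3" "h \<le> (w - t) / 4"
        unfolding h_def using e w by (simp, intro min.cobounded1, intro min.cobounded2)
      obtain v where v: "\<bar>v - u\<bar> \<le> h" "\<bar>x v - y u\<bar> \<le> h"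
        using approx[OF u(3) h(1)] by blast
      have "t < v" "v < w" using v(1) h(3) w(1) unfolding u_def by argo+
      then have "dist (x v) (x t) < e / 3" using b(2)[of v] w by auto
      moreover have "dist (y u) (y t) < e / 3" using c(2)[of u] u w by auto
      ultimately show ?thesis using v(2) h(2) unfolding dist_real_def by linarith
    qed
    then have "\<bar>x t - y t\<bar> \<le> 0" by (rule field_le_epsilon)
    then show ?thesis by simp
  qed
  have "x \<in> extensional {0..1}" "y \<in> extensional {0..1}"
    using x y by (auto simp: cadlag01_def)
  then show ?thesis using eq by (rule extensionalityI)
qed

lemma Metric_space_skorohod: "Metric_space cadlag01 skorohod_dist"
proof
  fix x y :: "real \<Rightarrow> real"
  show "0 \<le> skorohod_dist x y"
  proof (cases "x \<in> cadlag01 \<and> y \<in> cadlag01")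
    case True
    then have "0 \<le> Inf (skorohod_bounds x y)"
      by (intro cInf_greatest skorohod_bounds_nonempty) (auto simp: skorohod_bounds_def)
    then show ?thesis using True by (simp add: skorohod_dist_def)
  qed (auto simp: skorohod_dist_def)
  have "skorohod_bounds x y = skorohod_bounds y x"
    by (intro subset_antisym skorohod_bounds_sym)
  then show "skorohod_dist x y = skorohod_dist y x"
    by (simp add: skorohod_dist_def)
next
  fix x y assume x: "x \<in> cadlag01" and y: "y \<in> cadlag01"
  have "skorohod_dist x x = 0"
  proof -
    have "e \<in> skorohod_bounds x x" if "e > 0" for e
      using that time_changes_id by (auto simp: skorohod_bounds_def intro!: bexI[of _ "\<lambda>t. t"])
    then have "skorohod_bounds x x = {0<..}"
      by (auto simp: skorohod_bounds_def)
    then show ?thesis using x by (simp add: skorohod_dist_def)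
  qed
  then show "skorohod_dist x y = 0 \<longleftrightarrow> x = y"
    using skorohod_dist_zero_imp_eq[OF x y] by auto
next
  fix x y z assume xyz: "x \<in> cadlag01" "y \<in> cadlag01" "z \<in> cadlag01"
  have "Inf (skorohod_bounds x z) - e \<le> Inf (skorohod_bounds x y)"
    if e: "e \<in> skorohod_bounds y z" for e
  proof (rule cInf_greatest[OF skorohod_bounds_nonempty[OF xyz(1,2)]])
    fix d assume "d \<in> skorohod_bounds x y"
    then have "Inf (skorohod_bounds x z) \<le> d + e"
      using e by (intro cInf_lower skorohod_bounds_add skorohod_bounds_bdd_below)
    then show "Inf (skorohod_bounds x z) - e \<le> d" by simp
  qed
  then have "Inf (skorohod_bounds x z) - Inf (skorohod_bounds x y) \<le> Inf (skorohod_bounds y z)"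
    by (intro cInf_greatest skorohod_bounds_nonempty xyz) (auto simp: algebra_simps)
  then show "skorohod_dist x z \<le> skorohod_dist x y + skorohod_dist y z"
    using xyz by (simp add: skorohod_dist_def)
qed

lemma mspace_D01 [simp]: "mspace D01 = cadlag01"
  and mdist_D01 [simp]: "mdist D01 = skorohod_dist"
  by (simp_all add: D01_def Metric_space.mspace_metric Metric_space.mdist_metric
      Metric_space_skorohod)


section \<open>Brownian motion and weak convergence\<close>

definition brownian_motion01 :: "'b measure \<Rightarrow> (real \<Rightarrow> 'b \<Rightarrow> real) \<Rightarrow> bool" where
  "brownian_motion01 P W \<longleftrightarrow>
     prob_space P \<and>
     (\<forall>t\<in>{0..1}. W t \<in> borel_measurable P) \<and>
     (AE \<omega> in P. W 0 \<omega> = 0) \<and>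
     (\<forall>s t. 0 \<le> s \<and> s < t \<and> t \<le> 1 \<longrightarrow>
        distributed P lborel (\<lambda>\<omega>. W t \<omega> - W s \<omega>) (normal_density 0 (sqrt (t - s)))) \<and>
     (\<forall>n (\<tau>::nat \<Rightarrow> real).
        0 \<le> \<tau> 0 \<and> (\<forall>i<n. \<tau> i \<le> \<tau> (Suc i)) \<and> \<tau> n \<le> 1 \<longrightarrow>
        prob_space.indep_vars P (\<lambda>_. borel) (\<lambda>i \<omega>. W (\<tau> (Suc i)) \<omega> - W (\<tau> i) \<omega>) {..<n}) \<and>
     (AE \<omega> in P. continuous_on {0..1} (\<lambda>t. W t \<omega>))"

text \<open>The law of a standard Brownian motion as a random element of a path space: the Borel
  probability measure under which the coordinate process is a Brownian motion. On
  \<^const>\<open>C01\<close> and on \<^const>\<open>D01\<close> there is exactly one such measure.\<close>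

definition wiener_measure_on :: "(real \<Rightarrow> real) metric \<Rightarrow> (real \<Rightarrow> real) measure \<Rightarrow> bool" where
  "wiener_measure_on m \<nu> \<longleftrightarrow>
     space \<nu> = mspace m \<and>
     sets \<nu> = sigma_sets (mspace m) {U. openin (mtopology_of m) U} \<and>
     brownian_motion01 \<nu> (\<lambda>t x. x t)"

definition converges_weakly :: "'a measure \<Rightarrow> 'e metric \<Rightarrow> (nat \<Rightarrow> 'a \<Rightarrow> 'e) \<Rightarrow> 'e measure \<Rightarrow> bool" where
  "converges_weakly M m X \<nu> \<longleftrightarrow>
     (\<forall>\<phi>. continuous_map (mtopology_of m) euclideanreal \<phi> \<and> bounded (\<phi> ` mspace m) \<longrightarrow>
        (\<lambda>n. \<integral>\<omega>. \<phi> (X n \<omega>) \<partial>M) \<longlonglongrightarrow> (\<integral>x. \<phi> x \<partial>\<nu>))"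

definition clt_holds :: "'a measure \<Rightarrow> ('a \<Rightarrow> 'a) \<Rightarrow> ('a \<Rightarrow> real) \<Rightarrow> (nat \<Rightarrow> real) \<Rightarrow> bool" where
  "clt_holds M T f a \<longleftrightarrow>
     weak_conv_m (\<lambda>n. distr M borel (\<lambda>\<omega>. psum T f n \<omega> / a n)) std_normal_distribution"

text \<open>The normalized partial sum processes: linearly interpolated, respectively piecewise
  constant. For measurable \<open>f\<close> and \<open>T\<close> both are Borel random elements of \<^const>\<open>C01\<close>,
  respectively \<^const>\<open>D01\<close>, since a path depends continuously on the finitely many values
  \<open>f \<circ> T\<^sup>j\<close>, \<open>j \<le> n\<close>.\<close>

definition interpolated_path ::
  "('a \<Rightarrow> 'a) \<Rightarrow> ('a \<Rightarrow> real) \<Rightarrow> (nat \<Rightarrow> real) \<Rightarrow> nat \<Rightarrow> 'a \<Rightarrow> real \<Rightarrow> real" where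
  "interpolated_path T f a n \<omega> = (\<lambda>t\<in>{0..1}.
     (psum T f (nat \<lfloor>real n * t\<rfloor>) \<omega>
       + (real n * t - of_int \<lfloor>real n * t\<rfloor>) * f ((T ^^ nat \<lfloor>real n * t\<rfloor>) \<omega>)) / a n)"

definition step_path ::
  "('a \<Rightarrow> 'a) \<Rightarrow> ('a \<Rightarrow> real) \<Rightarrow> (nat \<Rightarrow> real) \<Rightarrow> nat \<Rightarrow> 'a \<Rightarrow> real \<Rightarrow> real" where
  "step_path T f a n \<omega> = (\<lambda>t\<in>{0..1}. psum T f (nat \<lfloor>real n * t\<rfloor>) \<omega> / a n)"

definition wip_C_holds :: "'a measure \<Rightarrow> ('a \<Rightarrow> 'a) \<Rightarrow> ('a \<Rightarrow> real) \<Rightarrow> (nat \<Rightarrow> real) \<Rightarrow> bool" where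
  "wip_C_holds M T f a \<longleftrightarrow>
     (\<exists>\<nu>. wiener_measure_on C01 \<nu> \<and> converges_weakly M C01 (interpolated_path T f a) \<nu>)"

definition wip_D_holds :: "'a measure \<Rightarrow> ('a \<Rightarrow> 'a) \<Rightarrow> ('a \<Rightarrow> real) \<Rightarrow> (nat \<Rightarrow> real) \<Rightarrow> bool" where
  "wip_D_holds M T f a \<longleftrightarrow>
     (\<exists>\<nu>. wiener_measure_on D01 \<nu> \<and> converges_weakly M D01 (step_path T f a) \<nu>)"


section \<open>Absolute regularity\<close>

text \<open>Empty blocks, which \<^const>\<open>partition_on\<close> excludes, contribute nothing to the sum. For a
  probability measure the sums are bounded by 2, so the real supremum is the true one.\<close>

definition beta_coeff :: "'a measure \<Rightarrow> 'a set set \<Rightarrow> 'a set set \<Rightarrow> real" where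
  "beta_coeff M \<A> \<B> = 1/2 * Sup {\<Sum>A\<in>P. \<Sum>B\<in>Q. \<bar>measure M (A \<inter> B) - measure M A * measure M B\<bar> | P Q.
     finite P \<and> P \<subseteq> \<A> \<and> partition_on (space M) P \<and>
     finite Q \<and> Q \<subseteq> \<B> \<and> partition_on (space M) Q}"

definition generated_sigma :: "'a measure \<Rightarrow> (int \<Rightarrow> 'a \<Rightarrow> real) \<Rightarrow> int set \<Rightarrow> 'a set set" where
  "generated_sigma M X K =
     sigma_sets (space M) {X k -` B \<inter> space M | k B. k \<in> K \<and> B \<in> sets borel}"

definition beta_mixing :: "'a measure \<Rightarrow> (int \<Rightarrow> 'a \<Rightarrow> real) \<Rightarrow> nat \<Rightarrow> real" where
  "beta_mixing M X n = beta_coeff M (generated_sigma M X {..0}) (generated_sigma M X {int n..})"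

end

theory Submission
  imports Defs
begin

text \<open>
  The function is \<open>f = \<epsilon> + g - g \<circ> T\<close>, where the \<open>\<epsilon> \<circ> T\<^sup>j\<close> are independent standard normal and \<open>g\<close>,
  independent of them, is the upper envelope of rare tents: at scale \<open>k\<close> each site carries a tent of
  slope 1 and height \<open>L k\<close> with probability \<open>1 / (L k)\<^sup>2\<close>. The coboundary \<open>g - g \<circ> T\<close> is bounded
  by 1 and \<open>g - g \<circ> T\<^sup>n\<close> is tight, so the moments and the central limit theorem are those of
  \<open>\<epsilon>\<close>; the tail bound \<open>P (g > h) \<le> 4 / (h + 1)\<close> gives \<open>E (g - g \<circ> T\<^sup>n)\<^sup>2 = O(n)\<close>. But for
  \<open>n = (L k)\<^sup>2\<close> there is, with probability bounded away from 0, a tent of height \<open>\<surd>n\<close> among the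
  first \<open>n\<close> sites, and it produces a dip of macroscopic depth in the normalized path over a time
  interval of length \<open>o(1)\<close>, which Brownian motion does not have. If \<open>L\<close> grows fast enough, then
  across a gap of length \<open>2 * L k + 2\<close> only tents of scale larger than \<open>k\<close> create
  dependence, and these are very rare.
\<close>

section \<open>The probability space\<close>

text \<open>Index \<open>(0, i)\<close> carries the Gaussian noise at site \<open>i\<close>; index
  \<open>(Suc k, i)\<close> carries the uniform variable that decides about a tent of scale
  \<open>k\<close> at site \<open>i\<close>.\<close>

definition coord :: "nat \<times> int \<Rightarrow> real measure" where
  "coord i = (if fst i = 0 then std_normal_distribution else uniform_measure lborel {0..1})"

definition pspace :: "(nat \<times> int \<Rightarrow> real) measure" where
  "pspace = PiM UNIV coord"

definition shift_by :: "int \<Rightarrow> (nat \<times> int \<Rightarrow> real) \<Rightarrow> nat \<times> int \<Rightarrow> real" where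
  "shift_by j \<omega> = (\<lambda>(a, i). \<omega> (a, i + j))"

text \<open>A symmetry of the measure that reverses the noise and leaves the tents alone. It stands
  in for the independence of noise and tents: whatever is odd in the noise integrates to
  zero.\<close>

definition flip :: "(nat \<times> int \<Rightarrow> real) \<Rightarrow> nat \<times> int \<Rightarrow> real" where
  "flip \<omega> = (\<lambda>i. if fst i = 0 then - \<omega> i else \<omega> i)"

abbreviation shift where "shift \<equiv> shift_by 1"

section \<open>Coordinates: measurability, laws and independence\<close>

lemma sets_coord [measurable_cong, simp]: "sets (coord i) = sets borel"
  by (simp add: coord_def)

lemma space_coord [simp]: "space (coord i) = UNIV"
  by (simp add: coord_def)

lemma prob_space_coord: "prob_space (coord i)"
proof (cases "fst i = 0")
  case True
  then show ?thesis using real_dist_normal_dist real_distribution_def by (simp add: coord_def)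
next
  case False
  then show ?thesis by (auto simp: coord_def intro!: prob_space_uniform_measure)
qed

interpretation coords: product_prob_space coord UNIV
  by (rule product_prob_spaceI) (rule prob_space_coord)

interpretation P: prob_space pspace
  unfolding pspace_def by (rule coords.P.prob_space_axioms)

lemma space_pspace [simp]: "space pspace = UNIV"
  by (simp add: pspace_def space_PiM)

lemma sets_pspace_eq: "sets pspace = sets (PiM UNIV (\<lambda>_. borel))"
  unfolding pspace_def by (intro sets_PiM_cong) auto

lemma measurable_pspace_coordinate [measurable]: "(\<lambda>\<omega>. \<omega> i) \<in> borel_measurable pspace"
  unfolding pspace_def measurable_cong_sets[OF refl sets_coord[of i, symmetric]]
  by (rule measurable_component_singleton) simp

lemma measurable_to_pspace:
  "(\<And>i. (\<lambda>x. h x i) \<in> borel_measurable N) \<Longrightarrow> h \<in> measurable N pspace"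
  unfolding measurable_cong_sets[OF refl sets_pspace_eq]
  by (rule measurable_PiM_single') (auto simp: space_PiM)

lemma measurable_shift_by [measurable]: "shift_by j \<in> measurable pspace pspace"
  by (rule measurable_to_pspace) (simp add: shift_by_def split_beta)

lemma measurable_flip [measurable]: "flip \<in> measurable pspace pspace"
proof (rule measurable_to_pspace)
  show "(\<lambda>\<omega>. flip \<omega> i) \<in> borel_measurable pspace" for i
    by (cases "fst i = 0") (simp_all add: flip_def)
qed

lemma distr_coordinate: "distr pspace borel (\<lambda>\<omega>. \<omega> i) = coord i"
proof -
  have "distr pspace borel (\<lambda>\<omega>. \<omega> i) = distr pspace (coord i) (\<lambda>\<omega>. \<omega> i)"
    by (rule distr_cong[OF refl sets_coord[symmetric] refl])
  also have "\<dots> = coord i"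
    unfolding pspace_def by (rule coords.PiM_component[OF UNIV_I])
  finally show ?thesis .
qed

text \<open>The tuple of all coordinates is the identity map, whose law \<open>pspace\<close> is by
  construction the product of the coordinate laws.\<close>

lemma indep_coordinates: "P.indep_vars (\<lambda>_. borel) (\<lambda>i \<omega>. \<omega> i) UNIV"
proof -
  have "distr pspace (PiM UNIV (\<lambda>_. borel)) (\<lambda>\<omega>. \<lambda>i\<in>UNIV. \<omega> i) = distr pspace pspace (\<lambda>\<omega>. \<omega>)"
    by (intro distr_cong) (auto simp: sets_pspace_eq)
  also have "\<dots> = PiM UNIV (\<lambda>i. distr pspace borel (\<lambda>\<omega>. \<omega> i))"
    by (simp add: distr_coordinate) (simp add: pspace_def)
  finally show ?thesis
    by (subst P.indep_vars_iff_distr_eq_PiM) auto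
qed

section \<open>Invariance under site shifts and under the sign flip\<close>

text \<open>\<open>coord\<close> depends only on the first component of the index, so reindexing the
  product along the sites gives back the same product.\<close>

lemma distr_shift_by: "distr pspace pspace (shift_by j) = pspace"
proof -
  have "distr (PiM UNIV coord) (PiM UNIV (\<lambda>i. coord (fst i, snd i + j)))
      (\<lambda>\<omega>. \<lambda>i\<in>UNIV. \<omega> (fst i, snd i + j)) = PiM UNIV (\<lambda>i. coord (fst i, snd i + j))"
    by (rule distr_PiM_reindex) (auto intro: prob_space_coord simp: inj_on_def)
  moreover have "(\<lambda>i. coord (fst i, snd i + j)) = coord"
    by (simp add: coord_def fun_eq_iff)
  moreover have "(\<lambda>\<omega>. \<lambda>i\<in>UNIV. \<omega> (fst i, snd i + j)) = shift_by j"
    by (simp add: shift_by_def fun_eq_iff)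
  ultimately show ?thesis by (simp add: pspace_def)
qed

lemma distr_uminus_std_normal: "distr std_normal_distribution borel uminus = std_normal_distribution"
proof -
  interpret N: prob_space std_normal_distribution
    using real_dist_normal_dist by (simp add: real_distribution_def)
  have "distributed std_normal_distribution lborel (\<lambda>x. x) std_normal_density"
    by (auto simp: distributed_def intro!: distr_id2)
  from N.normal_density_affine[OF this, of "-1" 0]
  have "distributed std_normal_distribution lborel uminus std_normal_density" by simp
  then have "distr std_normal_distribution lborel uminus = std_normal_distribution"
    by (simp add: distributed_def)
  then show ?thesis by (metis distr_cong sets_lborel)
qed

text \<open>\<open>flip\<close> acts on each coordinate separately, so independence survives, and
  the symmetry of the standard normal law preserves every marginal.\<close>

lemma distr_flip: "distr pspace pspace flip = pspace"
proof -
  let ?Y = "\<lambda>i::nat \<times> int. if fst i = 0 then uminus else (\<lambda>x::real. x)"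
  have "P.indep_vars (\<lambda>_. borel) (\<lambda>i \<omega>. ?Y i (\<omega> i)) UNIV"
    by (rule P.indep_vars_compose2[OF indep_coordinates]) auto
  moreover have eq: "(\<lambda>i \<omega>. ?Y i (\<omega> i)) = (\<lambda>i \<omega>. flip \<omega> i)"
    by (simp add: flip_def fun_eq_iff)
  ultimately have ind: "P.indep_vars (\<lambda>_. borel) (\<lambda>i \<omega>. flip \<omega> i) UNIV" by metis
  have meas: "(\<lambda>\<omega>. flip \<omega> i) \<in> borel_measurable pspace" for i
    using measurable_compose[OF measurable_flip measurable_pspace_coordinate] .
  have "distr pspace pspace flip = distr pspace (PiM UNIV (\<lambda>_. borel)) (\<lambda>\<omega>. \<lambda>i\<in>UNIV. flip \<omega> i)"
    by (rule distr_cong) (simp_all add: sets_pspace_eq restrict_UNIV)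
  also have "\<dots> = PiM UNIV (\<lambda>i. distr pspace borel (\<lambda>\<omega>. flip \<omega> i))"
    using P.indep_vars_iff_distr_eq_PiM[OF UNIV_not_empty, of "\<lambda>i \<omega>. flip \<omega> i" "\<lambda>_. borel"] meas ind
    by blast
  also have "(\<lambda>i. distr pspace borel (\<lambda>\<omega>. flip \<omega> i)) = coord"
  proof
    fix i
    show "distr pspace borel (\<lambda>\<omega>. flip \<omega> i) = coord i"
    proof (cases "fst i = 0")
      case True
      then have "distr pspace borel (\<lambda>\<omega>. flip \<omega> i) = distr (distr pspace borel (\<lambda>\<omega>. \<omega> i)) borel uminus"
        by (subst distr_distr) (auto simp: flip_def comp_def)
      then show ?thesis
        using True unfolding distr_coordinate by (simp add: coord_def distr_uminus_std_normal)
    qed (simp add: flip_def distr_coordinate)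
  qed
  finally show ?thesis unfolding pspace_def .
qed

lemma shift_by_shift_by [simp]: "shift_by j (shift_by k \<omega>) = shift_by (j + k) \<omega>"
  by (simp add: shift_by_def fun_eq_iff algebra_simps)

lemma shift_by_0 [simp]: "shift_by 0 \<omega> = \<omega>"
  by (simp add: shift_by_def)

lemma shift_by_apply: "shift_by j \<omega> (a, i) = \<omega> (a, i + j)"
  by (simp add: shift_by_def)

lemma shift_funpow: "(shift_by j ^^ n) \<omega> = shift_by (int n * j) \<omega>"
  by (induction n arbitrary: \<omega>) (auto simp: algebra_simps)

lemma bij_shift_by: "bij (shift_by j)"
  by (rule bij_betw_byWitness[where f' = "shift_by (- j)"]) auto

lemma the_inv_shift: "the_inv_into UNIV shift = shift_by (- 1)"
proof
  fix \<omega>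
  have "the_inv_into UNIV shift (shift (shift_by (- 1) \<omega>)) = shift_by (- 1) \<omega>"
    by (rule the_inv_into_f_f) (use bij_shift_by[of 1] in \<open>auto simp: bij_def\<close>)
  then show "the_inv_into UNIV shift \<omega> = shift_by (- 1) \<omega>" by simp
qed

lemma invertible_shift: "invertible_mpt pspace shift"
  by (simp add: invertible_mpt_def bij_shift_by the_inv_shift distr_shift_by)

lemma stationary_process_shift: "stationary_process pspace shift f k \<omega> = f (shift_by k \<omega>)"
  by (simp add: stationary_process_def int_iterate_def the_inv_shift shift_funpow)

lemma prob_shift_by:
  assumes [measurable]: "A \<in> sets pspace"
  shows "P.prob {\<omega>. shift_by j \<omega> \<in> A} = P.prob A"
proof -
  have "P.prob A = measure (distr pspace pspace (shift_by j)) A" by (simp add: distr_shift_by)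
  also have "\<dots> = P.prob {\<omega>. shift_by j \<omega> \<in> A}"
    by (subst measure_distr) (auto simp: vimage_def)
  finally show ?thesis by simp
qed

lemma integral_shift_by:
  fixes h :: "_ \<Rightarrow> 'b::{banach, second_countable_topology}"
  assumes "h \<in> borel_measurable pspace"
  shows "(\<integral>\<omega>. h (shift_by j \<omega>) \<partial>pspace) = (\<integral>\<omega>. h \<omega> \<partial>pspace)"
  using integral_distr[OF measurable_shift_by assms, of j] by (simp add: distr_shift_by)

lemma integral_flip:
  fixes h :: "_ \<Rightarrow> 'b::{banach, second_countable_topology}"
  assumes "h \<in> borel_measurable pspace"
  shows "(\<integral>\<omega>. h (flip \<omega>) \<partial>pspace) = (\<integral>\<omega>. h \<omega> \<partial>pspace)"
  using integral_distr[OF measurable_flip assms] by (simp add: distr_flip)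

lemma integrable_flip:
  fixes h :: "_ \<Rightarrow> 'b::{banach, second_countable_topology}"
  assumes "integrable pspace h"
  shows "integrable pspace (\<lambda>\<omega>. h (flip \<omega>))"
proof -
  have "integrable (distr pspace pspace flip) h" unfolding distr_flip by (rule assms)
  from integrable_distr[OF measurable_flip this] show ?thesis .
qed

section \<open>The Gaussian part\<close>

definition gsum :: "nat \<Rightarrow> (nat \<times> int \<Rightarrow> real) \<Rightarrow> real" where
  "gsum n \<omega> = (\<Sum>j<n. \<omega> (0, int j))"

lemma measurable_gsum [measurable]: "gsum n \<in> borel_measurable pspace"
  unfolding gsum_def[abs_def] by measurable

lemma distributed_coordinate_0: "distributed pspace lborel (\<lambda>\<omega>. \<omega> (0, i)) (normal_density 0 1)"
proof -
  have "distr pspace lborel (\<lambda>\<omega>. \<omega> (0, i)) = distr pspace borel (\<lambda>\<omega>. \<omega> (0, i))"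
    by (intro distr_cong) auto
  then show ?thesis
    by (simp add: distributed_def distr_coordinate coord_def)
qed

lemma distributed_gsum:
  assumes "n > 0"
  shows "distributed pspace lborel (gsum n) (normal_density 0 (sqrt (real n)))"
proof -
  let ?I = "(\<lambda>j. (0::nat, int j)) ` {..<n}"
  have inj: "inj_on (\<lambda>j. (0::nat, int j)) {..<n}" by (auto simp: inj_on_def)
  have ind: "P.indep_vars (\<lambda>_. borel) (\<lambda>i \<omega>. \<omega> i) ?I"
    by (rule P.indep_vars_subset[OF indep_coordinates]) simp
  have "distributed pspace lborel (\<lambda>\<omega>. \<Sum>i\<in>?I. \<omega> i)
      (normal_density (\<Sum>i\<in>?I. 0) (sqrt (\<Sum>i\<in>?I. 1\<^sup>2)))"
    using P.sum_indep_normal[OF _ _ ind, of "\<lambda>_. 1" "\<lambda>_. 0"] assms distributed_coordinate_0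
    by force
  then show ?thesis using inj by (simp add: gsum_def[abs_def] sum.reindex card_image)
qed

text \<open>Normality is exact for every \<open>n > 0\<close>, so the central limit theorem reduces
  to the negligibility of the coboundary.\<close>

lemma distr_normalized_gsum:
  assumes "n > 0"
  shows "distr pspace borel (\<lambda>\<omega>. gsum n \<omega> / sqrt (real n)) = std_normal_distribution"
proof -
  have "distributed pspace lborel (\<lambda>\<omega>. (gsum n \<omega> - 0) / sqrt (real n)) std_normal_density"
    using distributed_gsum[OF assms] assms
    by (subst (asm) P.normal_standard_normal_convert) auto
  then have "distr pspace lborel (\<lambda>\<omega>. gsum n \<omega> / sqrt (real n)) = std_normal_distribution"
    by (simp add: distributed_def)
  then show ?thesis by (metis distr_cong sets_lborel)
qed

lemma gsum_square:
  shows "integrable pspace (\<lambda>\<omega>. (gsum n \<omega>)\<^sup>2)" and "(\<integral>\<omega>. (gsum n \<omega>)\<^sup>2 \<partial>pspace) = real n"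
proof -
  have "integrable pspace (\<lambda>\<omega>. (gsum n \<omega>)\<^sup>2) \<and> (\<integral>\<omega>. (gsum n \<omega>)\<^sup>2 \<partial>pspace) = real n"
  proof (cases "n = 0")
    case False
    have sq: "distr pspace borel (\<lambda>\<omega>. gsum n \<omega> / sqrt (real n)) = std_normal_distribution"
      by (rule distr_normalized_gsum) (use False in simp)
    have I: "integrable (distr pspace borel (\<lambda>\<omega>. gsum n \<omega> / sqrt (real n))) (\<lambda>x. x ^ 2)"
      "(\<integral>x. x ^ 2 \<partial>distr pspace borel (\<lambda>\<omega>. gsum n \<omega> / sqrt (real n))) = 1"
      unfolding sq using std_normal_distribution_even_moments[of 1] by (auto simp: fact_numeral)
    have "integrable pspace (\<lambda>\<omega>. (gsum n \<omega> / sqrt (real n))\<^sup>2)"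
      using I(1) by (subst (asm) integrable_distr_eq) auto
    moreover have "(\<integral>\<omega>. (gsum n \<omega> / sqrt (real n))\<^sup>2 \<partial>pspace) = 1"
      using I(2) by (subst (asm) integral_distr) auto
    ultimately have D: "integrable pspace (\<lambda>\<omega>. (gsum n \<omega>)\<^sup>2 / real n)"
      "(\<integral>\<omega>. (gsum n \<omega>)\<^sup>2 / real n \<partial>pspace) = 1"
      by (simp_all add: power_divide)
    have "integrable pspace (\<lambda>\<omega>. real n * ((gsum n \<omega>)\<^sup>2 / real n))"
      using D(1) by (rule integrable_mult_right)
    then show ?thesis using D(2) False by simp
  qed (simp add: gsum_def)
  then show "integrable pspace (\<lambda>\<omega>. (gsum n \<omega>)\<^sup>2)" "(\<integral>\<omega>. (gsum n \<omega>)\<^sup>2 \<partial>pspace) = real n" by auto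
qed

lemma integrable_coordinate_0_power: "integrable pspace (\<lambda>\<omega>. \<bar>\<omega> (0, i)\<bar> ^ k)"
proof -
  have "integrable (coord (0, i)) (\<lambda>x. \<bar>x ^ k\<bar>)"
    unfolding coord_def by (simp del: power_abs add: integrable_std_normal_distribution_moment)
  then have "integrable (distr pspace borel (\<lambda>\<omega>. \<omega> (0, i))) (\<lambda>x. \<bar>x\<bar> ^ k)"
    by (simp add: distr_coordinate power_abs)
  then show ?thesis by (subst (asm) integrable_distr_eq) auto
qed

lemma gsum_flip [simp]: "gsum n (flip \<omega>) = - gsum n \<omega>"
  by (simp add: gsum_def flip_def sum_negf)

lemma prob_uniform_coordinate:
  assumes "0 \<le> p" "p \<le> 1"
  shows "measure (coord (Suc k, i)) {..<p} = p"
proof -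
  have "{0..1} \<inter> {..<p} = {0..<p}" using assms by auto
  then show ?thesis using assms by (simp add: coord_def)
qed

section \<open>The coboundary\<close>

text \<open>Doubling makes the sum of \<open>1 / L k\<close> over all scales from \<open>k0\<close>
  on at most \<open>2 / L k0\<close>. The faster growth that the mixing rate demands is imposed only
  in \<open>tents_exists\<close>.\<close>

locale tents =
  fixes L :: "nat \<Rightarrow> nat"
  assumes L_pos: "0 < L k" and L_double: "2 * L k \<le> L (Suc k)"
begin

definition hit :: "nat \<Rightarrow> int \<Rightarrow> (nat \<times> int \<Rightarrow> real) \<Rightarrow> bool" where
  "hit k i \<omega> \<longleftrightarrow> \<omega> (Suc k, i) < 1 / (real (L k))\<^sup>2"

text \<open>A hit at scale \<open>k\<close> and site \<open>i\<close> puts a tent with apex \<open>L k\<close> there, and \<open>R h\<close> says that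
  some tent exceeds \<open>h\<close> at the origin. On the null set where these are unbounded, \<open>LEAST\<close>
  makes \<open>g\<close> an unspecified constant, which is still invariant under all shifts.\<close>

definition R :: "nat \<Rightarrow> (nat \<times> int \<Rightarrow> real) \<Rightarrow> bool" where
  "R h \<omega> \<longleftrightarrow> (\<exists>k i. hit k i \<omega> \<and> int h + \<bar>i\<bar> < int (L k))"

definition g :: "(nat \<times> int \<Rightarrow> real) \<Rightarrow> nat" where
  "g \<omega> = (LEAST h. \<not> R h \<omega>)"

section \<open>The function and the deterministic shape of the envelope\<close>

definition f :: "(nat \<times> int \<Rightarrow> real) \<Rightarrow> real" where
  "f \<omega> = \<omega> (0, 0) + (real (g \<omega>) - real (g (shift \<omega>)))"

lemma L_power: "2 ^ k * L k0 \<le> L (k0 + k)"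
proof (induction k)
  case (Suc k)
  then show ?case using L_double[of "k0 + k"] by simp
qed simp

lemma L_strict: "strict_mono L"
proof (rule strict_monoI_Suc)
  show "L n < L (Suc n)" for n using L_double[of n] L_pos[of n] by linarith
qed

lemma L_ge: "k < L k"
proof -
  have "2 ^ k * 1 \<le> 2 ^ k * L 0" using L_pos[of 0] by (intro mult_le_mono) auto
  also have "\<dots> \<le> L k" using L_power[of k 0] by simp
  finally show ?thesis using less_exp[of k] by linarith
qed

lemma hit_shift_by: "hit k i (shift_by j \<omega>) \<longleftrightarrow> hit k (i + j) \<omega>"
  by (simp add: hit_def shift_by_apply)

lemma hit_flip [simp]: "hit k i (flip \<omega>) \<longleftrightarrow> hit k i \<omega>"
  by (simp add: hit_def flip_def)

lemma R_shift_by: "R h (shift_by j \<omega>) \<longleftrightarrow> (\<exists>k i. hit k i \<omega> \<and> int h + \<bar>i - j\<bar> < int (L k))"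
  unfolding R_def hit_shift_by by (metis add_diff_cancel_right' diff_add_cancel)

lemma R_flip [simp]: "R h (flip \<omega>) \<longleftrightarrow> R h \<omega>"
  by (simp add: R_def)

lemma g_flip [simp]: "g (flip \<omega>) = g \<omega>"
  by (simp add: g_def)

lemma shift_by_flip: "shift_by j (flip \<omega>) = flip (shift_by j \<omega>)"
  by (simp add: shift_by_def flip_def fun_eq_iff)

lemma R_antimono: "R h' \<omega> \<Longrightarrow> h \<le> h' \<Longrightarrow> R h \<omega>"
  unfolding R_def by (meson add_right_mono le_less_trans of_nat_mono)

text \<open>Moving the viewpoint by \<open>j\<close> lowers a tent of slope one by at most the
  absolute value of \<open>j\<close>.\<close>

lemma R_add_shift_by:
  assumes "R (h + nat \<bar>j\<bar>) \<omega>" shows "R h (shift_by j \<omega>)"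
proof -
  obtain k i where "hit k i \<omega>" "int (h + nat \<bar>j\<bar>) + \<bar>i\<bar> < int (L k)" using assms by (auto simp: R_def)
  moreover have "int h + \<bar>i - j\<bar> \<le> int (h + nat \<bar>j\<bar>) + \<bar>i\<bar>" by linarith
  ultimately show ?thesis unfolding R_shift_by by (meson le_less_trans)
qed

lemma less_g_imp_R: "h < g \<omega> \<Longrightarrow> R h \<omega>"
  unfolding g_def using not_less_Least by blast

lemma not_R_g: "\<not> R h \<omega> \<Longrightarrow> \<not> R (g \<omega>) \<omega>"
  unfolding g_def by (rule LeastI)

text \<open>The level \<open>h'\<close> witnesses that the \<open>LEAST\<close> defining
  \<open>g\<close> is attained. A lower bound on \<open>g\<close> asks for such a witness, since the
  value is unspecified otherwise.\<close>

lemma R_imp_less_g: "\<not> R h' \<omega> \<Longrightarrow> R h \<omega> \<Longrightarrow> h < g \<omega>"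
  using not_R_g R_antimono by (meson not_less)

lemma g_shift_by_le: "g (shift_by j \<omega>) \<le> g \<omega> + nat \<bar>j\<bar>"
proof (cases "\<exists>h. \<not> R h \<omega>")
  case True
  then have "\<not> R (g \<omega>) \<omega>" using not_R_g by blast
  then have "\<not> R (g \<omega> + nat \<bar>j\<bar>) (shift_by j \<omega>)"
    using R_add_shift_by[of "g \<omega>" "- j" "shift_by j \<omega>"] by auto
  then show ?thesis unfolding g_def[of "shift_by j \<omega>"] by (rule Least_le)
next
  case False
  then have "R h (shift_by j \<omega>)" for h using R_add_shift_by by blast
  \<comment> \<open>Both \<open>LEAST\<close> operators now select from a predicate that is false
    everywhere, so they return the same unspecified number.\<close>
  then have "g (shift_by j \<omega>) = g \<omega>" using False by (simp add: g_def)
  then show ?thesis by simp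
qed

lemma g_shift_by_diff: "\<bar>real (g \<omega>) - real (g (shift_by j \<omega>))\<bar> \<le> \<bar>real_of_int j\<bar>"
  using g_shift_by_le[of j \<omega>] g_shift_by_le[of "- j" "shift_by j \<omega>"] by simp

lemma measurable_hit [measurable]: "Measurable.pred pspace (hit k i)"
  unfolding hit_def by measurable

lemma measurable_R [measurable]: "Measurable.pred pspace (R h)"
  unfolding R_def by measurable

lemma measurable_g [measurable]: "g \<in> measurable pspace (count_space UNIV)"
  unfolding g_def by measurable

lemma measurable_f [measurable]: "f \<in> borel_measurable pspace"
  unfolding f_def[abs_def] by measurable

lemma sets_R [measurable]: "{\<omega>. R h \<omega>} \<in> sets pspace"
  using measurable_R[of h] by (simp add: pred_def)

section \<open>Tail and truncated second moment of the envelope\<close>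

lemma prob_hit: "P.prob {\<omega>. hit k i \<omega>} = 1 / (real (L k))\<^sup>2"
proof -
  let ?p = "1 / (real (L k))\<^sup>2"
  have p: "0 \<le> ?p" "?p \<le> 1" using L_pos[of k] by auto
  have "P.prob {\<omega>. hit k i \<omega>} = measure (distr pspace borel (\<lambda>\<omega>. \<omega> (Suc k, i))) {..<?p}"
    by (subst measure_distr) (auto simp: hit_def[abs_def] vimage_def)
  then show ?thesis by (simp add: distr_coordinate prob_uniform_coordinate[OF p])
qed

text \<open>A union bound. Tents below scale \<open>k0\<close> are too low to exceed
  \<open>h\<close>. At a scale \<open>l\<close> from \<open>k0\<close> on, fewer than
  \<open>2 * L l\<close> sites are close enough to the origin, each hit with probability
  \<open>1 / (L l)^2\<close>; the scale thus contributes at most \<open>2 / L l\<close>, and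
  doubling sums this to \<open>4 / L k0\<close>.\<close>

lemma prob_R_le:
  assumes small: "\<And>k. k < k0 \<Longrightarrow> L k \<le> h"
  shows "P.prob {\<omega>. R h \<omega>} \<le> 4 / real (L k0)"
proof -
  define A where "A k = (\<Union>i\<in>{- int (L (k0 + k))<..<int (L (k0 + k))}. {\<omega>. hit (k0 + k) i \<omega>})" for k
  have hit_sets: "{\<omega>. hit k i \<omega>} \<in> sets pspace" for k i
    using measurable_hit[of k i] by (simp add: pred_def)
  then have A_sets: "range A \<subseteq> sets pspace" by (auto simp: A_def)
  have A_le: "P.prob (A k) \<le> 2 / real (L k0) * (1 / 2) ^ k" for k
  proof -
    let ?l = "L (k0 + k)"
    have "P.prob (A k) \<le> (\<Sum>i\<in>{- int ?l<..<int ?l}. P.prob {\<omega>. hit (k0 + k) i \<omega>})"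
      unfolding A_def by (rule P.finite_measure_subadditive_finite) (use hit_sets in auto)
    also have "\<dots> = (2 * real ?l - 1) / (real ?l)\<^sup>2"
      using L_pos[of "k0 + k"] by (simp add: prob_hit of_nat_diff algebra_simps)
    also have "\<dots> \<le> 2 * real ?l / (real ?l)\<^sup>2"
      by (intro divide_right_mono) auto
    also have "\<dots> = 2 / real ?l" using L_pos[of "k0 + k"] by (simp add: power2_eq_square)
    also have "\<dots> \<le> 2 / (2 ^ k * real (L k0))"
    proof (intro divide_left_mono)
      have "real (2 ^ k * L k0) \<le> real ?l" using L_power[of k k0] by (rule of_nat_mono)
      then show "2 ^ k * real (L k0) \<le> real ?l" by simp
    qed (use L_pos[of "k0 + k"] L_pos[of k0] in auto)
    finally show ?thesis by (simp add: field_simps)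
  qed
  have sm: "(\<lambda>k. 2 / real (L k0) * (1 / 2) ^ k) sums (2 / real (L k0) * 2)"
    using geometric_sums[of "1 / 2 :: real"] by (intro sums_mult) simp
  have sm': "summable (\<lambda>k. P.prob (A k))"
    by (rule summable_comparison_test'[OF sums_summable[OF sm], of 0]) (use A_le in auto)
  have "{\<omega>. R h \<omega>} \<subseteq> (\<Union>k. A k)"
  proof
    fix \<omega> assume "\<omega> \<in> {\<omega>. R h \<omega>}"
    then obtain k i where ki: "hit k i \<omega>" "int h + \<bar>i\<bar> < int (L k)" by (auto simp: R_def)
    then have "\<not> L k \<le> h" by linarith
    then have "k0 \<le> k" using small by (meson not_less)
    then show "\<omega> \<in> (\<Union>k. A k)"
      using ki by (auto simp: A_def intro!: exI[of _ "k - k0"] bexI[of _ i])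
  qed
  then have "P.prob {\<omega>. R h \<omega>} \<le> P.prob (\<Union>k. A k)"
    using A_sets by (intro P.finite_measure_mono) auto
  also have "\<dots> \<le> (\<Sum>k. P.prob (A k))"
    by (rule P.finite_measure_subadditive_countably[OF A_sets sm'])
  also have "\<dots> \<le> (\<Sum>k. 2 / real (L k0) * (1 / 2) ^ k)"
    by (rule suminf_le[OF A_le sm' sums_summable[OF sm]])
  also have "\<dots> = 4 / real (L k0)" using sums_unique[OF sm] by simp
  finally show ?thesis .
qed

text \<open>For \<open>k0\<close> serves the first scale whose tents exceed \<open>h\<close>, so
  that \<open>h + 1\<close> is at most \<open>L k0\<close>; \<open>L_ge\<close> shows that it
  exists.\<close>

lemma prob_R: "P.prob {\<omega>. R h \<omega>} \<le> 4 / (real h + 1)"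
proof -
  define k0 where "k0 = (LEAST k. h < L k)"
  have "h < L k0" unfolding k0_def by (rule LeastI[of _ h]) (rule L_ge)
  have "P.prob {\<omega>. R h \<omega>} \<le> 4 / real (L k0)"
    by (rule prob_R_le) (use not_less_Least in \<open>force simp: k0_def\<close>)
  also have "\<dots> \<le> 4 / (real h + 1)"
    using \<open>h < L k0\<close> by (intro divide_left_mono) auto
  finally show ?thesis .
qed

lemma hit_imp_g_ge:
  assumes "\<not> R h \<omega>" "hit k j \<omega>"
  shows "L k \<le> g (shift_by j \<omega>)"
proof -
  have "\<not> R (h + nat \<bar>j\<bar>) (shift_by j \<omega>)"
    using assms(1) R_add_shift_by[of h "- j" "shift_by j \<omega>"] by auto
  \<comment> \<open>\<open>R\<close> asks for strict exceedance, so at its apex a tent exceeds the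
    levels up to \<open>L k - 1\<close> only; the strict inequality of \<open>R_imp_less_g\<close>
    restores the missing unit.\<close>
  moreover have "R (L k - 1) (shift_by j \<omega>)"
    unfolding R_shift_by using assms(2) L_pos[of k]
    by (intro exI[of _ k] exI[of _ j]) (simp add: of_nat_diff)
  ultimately show ?thesis using R_imp_less_g[of _ _ "L k - 1"] by fastforce
qed

text \<open>Layer-cake summation: \<open>m^2\<close> is the sum of \<open>2 * h + 1\<close> over
  \<open>h < m\<close>, and \<open>prob_R\<close> bounds the mean of each layer by
  \<open>(2 * h + 1) * 4 / (h + 1)\<close>, which is at most 8. Truncation at \<open>n\<close>
  leaves \<open>n\<close> layers.\<close>

lemma min_g_square:
  "(\<integral>\<omega>. (min (real n) (real (g \<omega>)))\<^sup>2 \<partial>pspace) \<le> 8 * real n"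
proof -
  have odd_sum: "(\<Sum>h<m. 2 * real h + 1) = (real m)\<^sup>2" for m
    by (induction m) (auto simp: power2_eq_square algebra_simps)
  have pw: "(min (real n) (real (g \<omega>)))\<^sup>2 \<le> (\<Sum>h<n. (2 * real h + 1) * indicator {\<omega>. R h \<omega>} \<omega>)" for \<omega>
  proof -
    have "(min (real n) (real (g \<omega>)))\<^sup>2 = (\<Sum>h<min n (g \<omega>). 2 * real h + 1)"
      by (simp add: odd_sum of_nat_min)
    also have "\<dots> = (\<Sum>h<min n (g \<omega>). (2 * real h + 1) * indicator {\<omega>. R h \<omega>} \<omega>)"
      by (intro sum.cong) (auto dest: less_g_imp_R)
    also have "\<dots> \<le> (\<Sum>h<n. (2 * real h + 1) * indicator {\<omega>. R h \<omega>} \<omega>)"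
      by (intro sum_mono2) auto
    finally show ?thesis .
  qed
  have ind: "integrable pspace (indicat_real {\<omega>. R h \<omega>})" for h
    by (rule integrable_real_indicator[OF sets_R]) (simp add: P.emeasure_eq_measure)
  have "(\<integral>\<omega>. (min (real n) (real (g \<omega>)))\<^sup>2 \<partial>pspace)
      \<le> (\<integral>\<omega>. (\<Sum>h<n. (2 * real h + 1) * indicator {\<omega>. R h \<omega>} \<omega>) \<partial>pspace)"
  proof (rule integral_mono_AE')
    show "integrable pspace (\<lambda>\<omega>. \<Sum>h<n. (2 * real h + 1) * indicator {\<omega>. R h \<omega>} \<omega>)"
      by (intro Bochner_Integration.integrable_sum integrable_mult_right ind)
    show "AE \<omega> in pspace. (min (real n) (real (g \<omega>)))\<^sup>2 \<le> (\<Sum>h<n. (2 * real h + 1) * indicator {\<omega>. R h \<omega>} \<omega>)"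
      using pw by auto
    show "AE \<omega> in pspace. 0 \<le> (\<Sum>h<n. (2 * real h + 1) * indicator {\<omega>. R h \<omega>} \<omega> :: real)"
      by (intro AE_I2 sum_nonneg) auto
  qed
  also have "\<dots> = (\<Sum>h<n. (2 * real h + 1) * P.prob {\<omega>. R h \<omega>})"
    using ind by (subst Bochner_Integration.integral_sum) auto
  also have "\<dots> \<le> (\<Sum>h<n. 8)"
  proof (intro sum_mono)
    fix h
    have "(2 * real h + 1) * P.prob {\<omega>. R h \<omega>} \<le> (2 * real h + 1) * (4 / (real h + 1))"
      by (intro mult_left_mono prob_R) auto
    also have "\<dots> \<le> 8" by (simp add: field_simps)
    finally show "(2 * real h + 1) * P.prob {\<omega>. R h \<omega>} \<le> 8" .
  qed
  finally show ?thesis by simp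
qed

section \<open>The telescoped coboundary\<close>

definition D :: "nat \<Rightarrow> (nat \<times> int \<Rightarrow> real) \<Rightarrow> real" where
  "D n \<omega> = real (g \<omega>) - real (g (shift_by (int n) \<omega>))"

lemma measurable_D [measurable]: "D n \<in> borel_measurable pspace"
  unfolding D_def[abs_def] by measurable

lemma abs_D_le: "\<bar>D n \<omega>\<bar> \<le> real n"
  using g_shift_by_diff[of \<omega> "int n"] by (simp add: D_def)

lemma D_flip [simp]: "D n (flip \<omega>) = D n \<omega>"
  by (simp add: D_def shift_by_flip)

text \<open>A difference of two nonnegative numbers is at most the larger one, and
  \<open>abs_D_le\<close> allows truncating both at \<open>n\<close>. By stationarity the two
  truncated second moments agree, each being at most \<open>8 * n\<close>.\<close>

lemma D_square:
  shows "integrable pspace (\<lambda>\<omega>. (D n \<omega>)\<^sup>2)" and "(\<integral>\<omega>. (D n \<omega>)\<^sup>2 \<partial>pspace) \<le> 16 * real n"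
proof -
  show "integrable pspace (\<lambda>\<omega>. (D n \<omega>)\<^sup>2)"
    by (rule P.integrable_const_bound[of _ "(real n)\<^sup>2"])
      (use abs_D_le[of n] in \<open>auto simp: abs_le_square_iff[symmetric]\<close>)
  have int: "integrable pspace (\<lambda>\<omega>. (min (real n) (real (g (shift_by j \<omega>))))\<^sup>2)" for j
    by (rule P.integrable_const_bound[of _ "(real n)\<^sup>2"]) (auto intro!: power_mono)
  have pw: "(D n \<omega>)\<^sup>2 \<le> (min (real n) (real (g \<omega>)))\<^sup>2 + (min (real n) (real (g (shift_by (int n) \<omega>))))\<^sup>2" for \<omega>
  proof -
    define a where "a = min (real n) (real (g \<omega>))"
    define b where "b = min (real n) (real (g (shift_by (int n) \<omega>)))"
    have ab: "a \<ge> 0" "b \<ge> 0" by (auto simp: a_def b_def)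
    have "\<bar>D n \<omega>\<bar> \<le> a \<or> \<bar>D n \<omega>\<bar> \<le> b"
      using abs_D_le[of n \<omega>] unfolding a_def b_def D_def by linarith
    then have "(D n \<omega>)\<^sup>2 \<le> a\<^sup>2 \<or> (D n \<omega>)\<^sup>2 \<le> b\<^sup>2"
      using ab by (metis abs_le_square_iff abs_of_nonneg)
    then show ?thesis unfolding a_def[symmetric] b_def[symmetric]
      using zero_le_power2[of a] zero_le_power2[of b] by linarith
  qed
  have "(\<integral>\<omega>. (D n \<omega>)\<^sup>2 \<partial>pspace) \<le> (\<integral>\<omega>. (min (real n) (real (g \<omega>)))\<^sup>2
      + (min (real n) (real (g (shift_by (int n) \<omega>))))\<^sup>2 \<partial>pspace)"
    using int[of 0] int[of "int n"] pw by (intro integral_mono_AE') auto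
  also have "\<dots> = (\<integral>\<omega>. (min (real n) (real (g \<omega>)))\<^sup>2 \<partial>pspace)
      + (\<integral>\<omega>. (min (real n) (real (g (shift_by (int n) \<omega>))))\<^sup>2 \<partial>pspace)"
    using int[of 0] int[of "int n"] by (intro Bochner_Integration.integral_add) auto
  also have "(\<integral>\<omega>. (min (real n) (real (g (shift_by (int n) \<omega>))))\<^sup>2 \<partial>pspace)
      = (\<integral>\<omega>. (min (real n) (real (g \<omega>)))\<^sup>2 \<partial>pspace)"
    by (rule integral_shift_by[of "\<lambda>\<omega>. (min (real n) (real (g \<omega>)))\<^sup>2"]) measurable
  finally show "(\<integral>\<omega>. (D n \<omega>)\<^sup>2 \<partial>pspace) \<le> 16 * real n"
    using min_g_square[of n] by linarith
qed

section \<open>Partial sums, moments and the central limit theorem\<close>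

lemma f_shift_by: "f (shift_by j \<omega>) = \<omega> (0, j) + (real (g (shift_by j \<omega>)) - real (g (shift_by (j + 1) \<omega>)))"
  by (simp add: f_def shift_by_apply add.commute)

lemma psum_eq: "psum shift f n \<omega> = gsum n \<omega> + D n \<omega>"
proof (induction n)
  case (Suc n)
  have "psum shift f (Suc n) \<omega> = psum shift f n \<omega> + f (shift_by (int n) \<omega>)"
    by (simp add: psum_def shift_funpow)
  then show ?case
    unfolding Suc.IH by (simp add: f_shift_by gsum_def D_def add.commute)
qed (simp add: psum_def gsum_def D_def)

lemma psum_variance_eq:
  "psum_variance pspace shift f n = real n + (\<integral>\<omega>. (D n \<omega>)\<^sup>2 \<partial>pspace)"
  "integrable pspace (\<lambda>\<omega>. (psum shift f n \<omega>)\<^sup>2)"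
proof -
  let ?h = "\<lambda>\<omega>. (gsum n \<omega> + D n \<omega>)\<^sup>2"
  have "integrable pspace (\<lambda>\<omega>. 2 * ((gsum n \<omega>)\<^sup>2 + (D n \<omega>)\<^sup>2))"
    using gsum_square D_square by auto
  then have int: "integrable pspace ?h"
  proof (rule Bochner_Integration.integrable_bound)
    have "(a + b)\<^sup>2 \<le> 2 * (a\<^sup>2 + b\<^sup>2)" for a b :: real
      using zero_le_power2[of "a - b"] by (simp add: power2_eq_square algebra_simps)
    then show "AE \<omega> in pspace. norm (?h \<omega>) \<le> norm (2 * ((gsum n \<omega>)\<^sup>2 + (D n \<omega>)\<^sup>2))"
      by (auto simp: abs_mult)
  qed measurable
  then show "integrable pspace (\<lambda>\<omega>. (psum shift f n \<omega>)\<^sup>2)" by (simp add: psum_eq)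
  \<comment> \<open>The cross term of \<open>gsum n\<close> and \<open>D n\<close> changes sign
    under \<open>flip\<close>, so averaging over the pair removes it.\<close>
  have "2 * (\<integral>\<omega>. ?h \<omega> \<partial>pspace) = (\<integral>\<omega>. ?h \<omega> + ?h (flip \<omega>) \<partial>pspace)"
    using integral_flip[of ?h] integrable_flip[OF int] int
    by (subst Bochner_Integration.integral_add) auto
  also have "\<dots> = (\<integral>\<omega>. 2 * ((gsum n \<omega>)\<^sup>2 + (D n \<omega>)\<^sup>2) \<partial>pspace)"
    by (intro Bochner_Integration.integral_cong) (auto simp: power2_eq_square algebra_simps)
  also have "\<dots> = 2 * (real n + (\<integral>\<omega>. (D n \<omega>)\<^sup>2 \<partial>pspace))"
    using gsum_square D_square by simp
  finally show "psum_variance pspace shift f n = real n + (\<integral>\<omega>. (D n \<omega>)\<^sup>2 \<partial>pspace)"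
    by (simp add: psum_variance_def psum_eq)
qed

lemma variance_asymp: "asymp_equal (psum_variance pspace shift f) (\<lambda>N. real N)"
  unfolding asymp_equal_def
\<comment> \<open>17 = 1 + 16: the Gaussian variance \<open>N\<close> plus the bound
  \<open>16 * N\<close> of \<open>D_square\<close>. In the other direction the Gaussian part alone
  suffices.\<close>
proof (intro exI[of _ 17] conjI allI impI)
  fix N :: nat assume "N \<ge> 1"
  have "0 \<le> (\<integral>\<omega>. (D N \<omega>)\<^sup>2 \<partial>pspace)" by simp
  then show "inverse 17 * psum_variance pspace shift f N \<le> real N"
    "real N \<le> 17 * psum_variance pspace shift f N"
    using D_square(2)[of N] by (auto simp: psum_variance_eq)
qed simp

lemma f_moments:
  assumes "p > 0"
  shows "integrable pspace (\<lambda>\<omega>. \<bar>f \<omega>\<bar> powr p)"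
proof -
  define k where "k = nat \<lceil>p\<rceil>"
  have k: "p \<le> real k" unfolding k_def by linarith
  have "integrable pspace (\<lambda>\<omega>. 2 ^ k * (\<bar>\<omega> (0, 0)\<bar> ^ k + 1))"
    using integrable_coordinate_0_power by auto
  then show ?thesis
  proof (rule Bochner_Integration.integrable_bound)
    have "\<bar>f \<omega>\<bar> powr p \<le> 2 ^ k * (\<bar>\<omega> (0, 0)\<bar> ^ k + 1)" for \<omega>
    proof -
      \<comment> \<open>\<open>?m\<close> is at least 1, which allows raising the exponent from
        \<open>p\<close> to the integer \<open>k\<close>.\<close>
      let ?x = "\<bar>\<omega> (0, 0)\<bar>" and ?m = "max \<bar>\<omega> (0, 0)\<bar> 1"
      have "\<bar>f \<omega>\<bar> \<le> ?x + 1" using g_shift_by_diff[of \<omega> 1] by (simp add: f_def)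
      also have "\<dots> \<le> 2 * ?m" by simp
      finally have "\<bar>f \<omega>\<bar> powr p \<le> (2 * ?m) powr p" using assms by (intro powr_mono2) auto
      also have "\<dots> \<le> (2 * ?m) powr real k" using k by (intro powr_mono) auto
      also have "\<dots> = (2 * ?m) ^ k" by (rule powr_realpow) auto
      also have "\<dots> = 2 ^ k * ?m ^ k" by (simp add: power_mult_distrib)
      also have "\<dots> \<le> 2 ^ k * (?x ^ k + 1)"
        by (intro mult_left_mono) (auto simp: max_def one_le_power)
      finally show ?thesis .
    qed
    then show "AE \<omega> in pspace. norm (\<bar>f \<omega>\<bar> powr p) \<le> norm (2 ^ k * (\<bar>\<omega> (0, 0)\<bar> ^ k + 1))"
      by auto
  qed measurable
qed

text \<open>The function \<open>g\<close> itself is not integrable, so it has to be truncated first.\<close>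

lemma D_mean: "(\<integral>\<omega>. D n \<omega> \<partial>pspace) = 0"
proof -
  define s where "s N \<omega> = min (real N) (real (g \<omega>)) - min (real N) (real (g (shift_by (int n) \<omega>)))" for N \<omega>
  have "(\<lambda>N. \<integral>\<omega>. s N \<omega> \<partial>pspace) \<longlonglongrightarrow> (\<integral>\<omega>. D n \<omega> \<partial>pspace)"
  proof (rule integral_dominated_convergence[where w = "\<lambda>_. real n"])
    show "AE \<omega> in pspace. (\<lambda>N. s N \<omega>) \<longlonglongrightarrow> D n \<omega>"
    proof (rule AE_I2)
      fix \<omega>
      have "\<forall>\<^sub>F N in sequentially. s N \<omega> = D n \<omega>"
        unfolding eventually_sequentially
        by (intro exI[of _ "max (g \<omega>) (g (shift_by (int n) \<omega>))"]) (auto simp: s_def D_def)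
      then show "(\<lambda>N. s N \<omega>) \<longlonglongrightarrow> D n \<omega>" by (rule tendsto_eventually)
    qed
    \<comment> \<open>Truncation is a contraction, so the bound on \<open>D n\<close> dominates
      uniformly in \<open>N\<close>.\<close>
    have "\<bar>s N \<omega>\<bar> \<le> real n" for N \<omega>
      using abs_D_le[of n \<omega>] unfolding s_def D_def by linarith
    then show "AE \<omega> in pspace. norm (s N \<omega>) \<le> real n" for N by simp
  qed (auto simp: s_def[abs_def])
  moreover have "(\<integral>\<omega>. s N \<omega> \<partial>pspace) = 0" for N
  proof -
    have int: "integrable pspace (\<lambda>\<omega>. min (real N) (real (g (shift_by j \<omega>))))" for j
      by (rule P.integrable_const_bound[of _ "real N"]) auto
    show ?thesis
      using integral_shift_by[of "\<lambda>\<omega>. min (real N) (real (g \<omega>))" "int n"] int[of 0] int[of "int n"]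
      by (simp add: s_def)
  qed
  ultimately show ?thesis by (simp add: LIMSEQ_const_iff)
qed

lemma f_zero_mean: "zero_mean_square_integrable pspace f"
proof -
  have f1: "psum shift f 1 \<omega> = f \<omega>" for \<omega> by (simp add: psum_def)
  have sq: "integrable pspace (\<lambda>\<omega>. (f \<omega>)\<^sup>2)" using psum_variance_eq(2)[of 1] by (simp only: f1)
  have int: "integrable pspace f" by (rule P.square_integrable_imp_integrable[OF _ sq]) measurable
  have i0: "integrable pspace (\<lambda>\<omega>. \<omega> (0, 0))"
    using integrable_coordinate_0_power[of 0 1] by (subst (asm) power_one_right) (rule integrable_abs_cancel, auto)
  have fl: "(\<lambda>\<omega>. \<omega> (0, 0)) \<in> borel_measurable pspace" by measurable
  \<comment> \<open>The mean equals its own negative by the flip symmetry.\<close>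
  have e0: "(\<integral>\<omega>. \<omega> (0, 0) \<partial>pspace) = 0"
    using integral_flip[OF fl] by (simp add: flip_def)
  have ig: "integrable pspace (D 1)"
    by (rule P.integrable_const_bound[of _ 1]) (use abs_D_le[of 1] in auto)
  have "(\<integral>\<omega>. f \<omega> \<partial>pspace) = (\<integral>\<omega>. \<omega> (0, 0) \<partial>pspace) + (\<integral>\<omega>. D 1 \<omega> \<partial>pspace)"
    using i0 ig by (subst Bochner_Integration.integral_add[symmetric]) (auto simp: f_def[abs_def] D_def)
  moreover have "(\<integral>\<omega>. D 1 \<omega> \<partial>pspace) = 0"
    by (rule D_mean)
  ultimately show ?thesis
    using sq int e0 by (simp add: zero_mean_square_integrable_def)
qed

text \<open>Characteristic functions are compared. That of the normalized \<open>gsum n\<close> is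
  already the normal one, and a perturbation by \<open>z\<close> inside the exponential changes it
  by at most the smaller of 2 and the absolute value of \<open>z\<close>.\<close>

lemma clt_f: "clt_holds pspace shift f (\<lambda>n. sqrt (real n))"
  unfolding clt_holds_def
proof (rule levy_continuity)
  show "real_distribution (distr pspace borel (\<lambda>\<omega>. psum shift f n \<omega> / sqrt (real n)))" for n
    by (rule P.real_distribution_distr) (simp add: psum_eq)
  show "real_distribution std_normal_distribution" by (rule real_dist_normal_dist)
  fix t :: real
  \<comment> \<open>The shifted envelope in \<open>D n\<close> moves with \<open>n\<close> and need
    not converge pointwise, but by stationarity its bound has the same integral as
    \<open>b n\<close>. Dominated convergence is therefore applied to the fixed \<open>g\<close>
    only.\<close>
  define b where "b n \<omega> = min 2 (\<bar>t\<bar> * real (g \<omega>) / sqrt (real n))" for n \<omega>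
  have b_meas [measurable]: "b n \<in> borel_measurable pspace" for n
    unfolding b_def[abs_def] by measurable
  have b_int: "integrable pspace (\<lambda>\<omega>. b n (shift_by j \<omega>))" for n j
    by (rule P.integrable_const_bound[of _ 2]) (auto simp: b_def)
  have "(\<lambda>n. \<integral>\<omega>. b n \<omega> \<partial>pspace) \<longlonglongrightarrow> (\<integral>\<omega>. 0 \<partial>pspace)"
  proof (rule integral_dominated_convergence[where w = "\<lambda>_. 2"])
    have "(\<lambda>n. min 2 (c / sqrt (real n))) \<longlonglongrightarrow> min 2 0" for c :: real
      by (intro tendsto_min tendsto_const real_tendsto_divide_at_top[OF tendsto_const]
          filterlim_compose[OF sqrt_at_top filterlim_real_sequentially])
    then show "AE \<omega> in pspace. (\<lambda>n. b n \<omega>) \<longlonglongrightarrow> 0" by (simp add: b_def)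
  qed (auto simp: b_def)
  then have lim: "(\<lambda>n. 2 * (\<integral>\<omega>. b n \<omega> \<partial>pspace)) \<longlonglongrightarrow> 0"
    by (intro tendsto_mult_right_zero) simp
  have bound: "norm (char (distr pspace borel (\<lambda>\<omega>. psum shift f n \<omega> / sqrt (real n))) t
      - char std_normal_distribution t) \<le> 2 * (\<integral>\<omega>. b n \<omega> \<partial>pspace)" if n: "n > 0" for n
  proof -
    let ?X = "\<lambda>\<omega>. gsum n \<omega> / sqrt (real n)" and ?Y = "\<lambda>\<omega>. D n \<omega> / sqrt (real n)"
    have i1: "integrable pspace (\<lambda>\<omega>. iexp (t * (?X \<omega> + ?Y \<omega>)))"
      by (rule P.integrable_const_bound[of _ 1]) auto
    have i2: "integrable pspace (\<lambda>\<omega>. iexp (t * ?X \<omega>))"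
      by (rule P.integrable_const_bound[of _ 1]) auto
    have c1: "char (distr pspace borel (\<lambda>\<omega>. psum shift f n \<omega> / sqrt (real n))) t
        = (\<integral>\<omega>. iexp (t * (?X \<omega> + ?Y \<omega>)) \<partial>pspace)"
      unfolding char_def by (subst integral_distr) (auto simp: psum_eq add_divide_distrib)
    have c2: "char std_normal_distribution t = (\<integral>\<omega>. iexp (t * ?X \<omega>) \<partial>pspace)"
      unfolding distr_normalized_gsum[OF n, symmetric] char_def by (subst integral_distr) auto
    have pw: "norm (iexp (t * (?X \<omega> + ?Y \<omega>)) - iexp (t * ?X \<omega>)) \<le> b n \<omega> + b n (shift_by (int n) \<omega>)" for \<omega>
    proof -
      let ?z = "t * ?Y \<omega>"
      have "iexp (t * (?X \<omega> + ?Y \<omega>)) - iexp (t * ?X \<omega>) = iexp (t * ?X \<omega>) * (iexp ?z - 1)"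
        by (simp add: algebra_simps exp_add[symmetric])
      then have "norm (iexp (t * (?X \<omega> + ?Y \<omega>)) - iexp (t * ?X \<omega>)) = norm (iexp ?z - 1)"
        by (simp add: norm_mult)
      moreover have "norm (iexp ?z - 1) \<le> \<bar>?z\<bar>" using iexp_approx1[of ?z 0] by simp
      moreover have "norm (iexp ?z - 1) \<le> 2"
        by (rule order_trans[OF norm_triangle_ineq4]) simp
      moreover have "\<bar>?z\<bar> \<le> \<bar>t\<bar> * real (g \<omega>) / sqrt (real n) + \<bar>t\<bar> * real (g (shift_by (int n) \<omega>)) / sqrt (real n)"
      proof -
        have "\<bar>?z\<bar> = \<bar>t\<bar> * \<bar>D n \<omega>\<bar> / sqrt (real n)" by (simp add: abs_mult)
        also have "\<dots> \<le> \<bar>t\<bar> * (real (g \<omega>) + real (g (shift_by (int n) \<omega>))) / sqrt (real n)"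
          by (intro divide_right_mono mult_left_mono) (auto simp: D_def)
        finally show ?thesis by (simp add: algebra_simps add_divide_distrib)
      qed
      moreover have "0 \<le> \<bar>t\<bar> * real (g \<omega>) / sqrt (real n)"
        "0 \<le> \<bar>t\<bar> * real (g (shift_by (int n) \<omega>)) / sqrt (real n)" by auto
      ultimately show ?thesis unfolding b_def by linarith
    qed
    have "norm (char (distr pspace borel (\<lambda>\<omega>. psum shift f n \<omega> / sqrt (real n))) t
        - char std_normal_distribution t)
      = norm (\<integral>\<omega>. iexp (t * (?X \<omega> + ?Y \<omega>)) - iexp (t * ?X \<omega>) \<partial>pspace)"
      unfolding c1 c2 by (subst Bochner_Integration.integral_diff[OF i1 i2]) simp
    also have "\<dots> \<le> (\<integral>\<omega>. norm (iexp (t * (?X \<omega> + ?Y \<omega>)) - iexp (t * ?X \<omega>)) \<partial>pspace)"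
      by (rule integral_norm_bound)
    also have "\<dots> \<le> (\<integral>\<omega>. b n \<omega> + b n (shift_by (int n) \<omega>) \<partial>pspace)"
      using pw b_int[of n 0] b_int[of n "int n"] i1 i2 by (intro integral_mono) auto
    also have "\<dots> = 2 * (\<integral>\<omega>. b n \<omega> \<partial>pspace)"
      using b_int[of n 0] b_int[of n "int n"] integral_shift_by[OF b_meas, of n "int n"] by simp
    finally show ?thesis .
  qed
  have "(\<lambda>n. char (distr pspace borel (\<lambda>\<omega>. psum shift f n \<omega> / sqrt (real n))) t
      - char std_normal_distribution t) \<longlonglongrightarrow> 0"
    by (rule Lim_null_comparison[OF _ lim]) (use bound in \<open>auto simp: eventually_sequentially intro!: exI[of _ 1]\<close>)
  then show "(\<lambda>n. char (distr pspace borel (\<lambda>\<omega>. psum shift f n \<omega> / sqrt (real n))) t)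
      \<longlonglongrightarrow> char std_normal_distribution t"
    by (simp add: LIM_zero_iff)
qed

end

section \<open>Absolute regularity\<close>

lemma (in prob_space) sum_prob_disjoint_le:
  assumes "finite I" "disjoint_family_on F I" "\<And>i. i \<in> I \<Longrightarrow> F i \<in> events" "E \<in> events"
  shows "(\<Sum>i\<in>I. prob (F i \<inter> E)) \<le> prob E"
proof -
  have "(\<Sum>i\<in>I. prob (F i \<inter> E)) = prob (\<Union>i\<in>I. F i \<inter> E)"
    using assms by (intro finite_measure_finite_Union[symmetric]) (auto simp: disjoint_family_on_def)
  also have "\<dots> \<le> prob E" using assms by (intro finite_measure_mono) auto
  finally show ?thesis .
qed

text \<open>Off the event \<open>N\<close> the two \<open>\<sigma>\<close>-algebras coincide with their pullbacks under \<open>r\<close> and \<open>s\<close>,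
  which are independent of each other.\<close>

lemma (in prob_space) beta_coeff_le_coupling:
  assumes r [measurable]: "r \<in> measurable M M" and s [measurable]: "s \<in> measurable M M"
    and N [measurable]: "N \<in> events"
    and \<A>: "\<A> \<subseteq> events" "space M \<in> \<A>" and \<B>: "\<B> \<subseteq> events" "space M \<in> \<B>"
    and rA: "\<And>A \<omega>. A \<in> \<A> \<Longrightarrow> \<omega> \<in> space M - N \<Longrightarrow> r \<omega> \<in> A \<longleftrightarrow> \<omega> \<in> A"
    and sB: "\<And>B \<omega>. B \<in> \<B> \<Longrightarrow> \<omega> \<in> space M - N \<Longrightarrow> s \<omega> \<in> B \<longleftrightarrow> \<omega> \<in> B"
    and ind: "indep_var M r M s"
  shows "beta_coeff M \<A> \<B> \<le> 3 * prob N"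
proof -
  \<comment> \<open>The error is kept as mass inside \<open>X\<close> and \<open>Y\<close>:
    partitions may have arbitrarily many blocks, and only errors localized in the blocks add up to a
    fixed multiple of \<open>prob N\<close>.\<close>
  have close: "\<bar>prob X - prob Y\<bar> \<le> prob (X \<inter> N) + prob (Y \<inter> N)"
    if X: "X \<in> events" and Y: "Y \<in> events" and XY: "\<And>\<omega>. \<omega> \<in> space M - N \<Longrightarrow> \<omega> \<in> X \<longleftrightarrow> \<omega> \<in> Y" for X Y
  proof -
    have "prob Z \<le> prob W + prob (Z \<inter> N)"
      if "Z \<in> events" "W \<in> events" "\<And>\<omega>. \<omega> \<in> space M - N \<Longrightarrow> \<omega> \<in> Z \<longleftrightarrow> \<omega> \<in> W" for Z W
    proof -
      have "Z \<subseteq> W \<union> (Z \<inter> N)" using that sets.sets_into_space[of Z M] by blast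
      then have "prob Z \<le> prob (W \<union> (Z \<inter> N))" using that by (intro finite_measure_mono) auto
      also have "\<dots> \<le> prob W + prob (Z \<inter> N)" using that by (intro measure_Un_le) auto
      finally show ?thesis .
    qed
    from this[OF X Y XY] this[OF Y X] XY show ?thesis
      using measure_nonneg[of M "X \<inter> N"] measure_nonneg[of M "Y \<inter> N"] by (smt (verit))
  qed
  have main: "(\<Sum>A\<in>P. \<Sum>B\<in>Q. \<bar>prob (A \<inter> B) - prob A * prob B\<bar>) \<le> 6 * prob N"
    if P: "finite P" "P \<subseteq> \<A>" "partition_on (space M) P"
      and Q: "finite Q" "Q \<subseteq> \<B>" "partition_on (space M) Q" for P Q
  proof -
    define r' where "r' A = r -` A \<inter> space M" for A
    define s' where "s' B = s -` B \<inter> space M" for B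
    have Pev: "A \<in> events" if "A \<in> P" for A using that P(2) \<A>(1) by blast
    have Qev: "B \<in> events" if "B \<in> Q" for B using that Q(2) \<B>(1) by blast
    have r'ev: "r' A \<in> events" if "A \<in> P" for A unfolding r'_def using Pev[OF that] by measurable
    have s'ev: "s' B \<in> events" if "B \<in> Q" for B unfolding s'_def using Qev[OF that] by measurable
    have Pdis: "disjoint_family_on (\<lambda>A. A) P" using P(3)
      by (auto simp: partition_on_def disjoint_def disjoint_family_on_def)
    have Qdis: "disjoint_family_on (\<lambda>B. B) Q" using Q(3)
      by (auto simp: partition_on_def disjoint_def disjoint_family_on_def)
    have r'dis: "disjoint_family_on r' P" using Pdis by (auto simp: r'_def disjoint_family_on_def)
    have s'dis: "disjoint_family_on s' Q" using Qdis by (auto simp: s'_def disjoint_family_on_def)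
    have r'A: "\<omega> \<in> A \<longleftrightarrow> \<omega> \<in> r' A" if "A \<in> P" "\<omega> \<in> space M - N" for A \<omega>
      using rA[of A \<omega>] that P(2) by (auto simp: r'_def)
    have s'B: "\<omega> \<in> B \<longleftrightarrow> \<omega> \<in> s' B" if "B \<in> Q" "\<omega> \<in> space M - N" for B \<omega>
      using sB[of B \<omega>] that Q(2) by (auto simp: s'_def)
    have indep: "prob (r' A \<inter> s' B) = prob (r' A) * prob (s' B)" if "A \<in> P" "B \<in> Q" for A B
    proof -
      have "(\<lambda>x. (r x, s x)) -` (A \<times> B) \<inter> space M = r' A \<inter> s' B" by (auto simp: r'_def s'_def)
      then show ?thesis using indep_varD[OF ind Pev[OF that(1)] Qev[OF that(2)]] by (simp add: r'_def s'_def)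
    qed
    let ?d = "\<lambda>A. prob (A \<inter> N) + prob (r' A \<inter> N)" and ?e = "\<lambda>B. prob (B \<inter> N) + prob (s' B \<inter> N)"
    \<comment> \<open>The joint probability is replaced by that of the pullbacks, which factorizes;
      then the marginals are exchanged back one factor at a time.\<close>
    have term_le: "\<bar>prob (A \<inter> B) - prob A * prob B\<bar> \<le> (prob (B \<inter> (A \<inter> N)) + prob (s' B \<inter> (r' A \<inter> N)))
        + (?d A * prob B + prob (r' A) * ?e B)" if A: "A \<in> P" and B: "B \<in> Q" for A B
    proof -
      have 1: "\<bar>prob (A \<inter> B) - prob (r' A \<inter> s' B)\<bar> \<le> prob (A \<inter> B \<inter> N) + prob (r' A \<inter> s' B \<inter> N)"
        using A B Pev Qev r'ev s'ev r'A s'B by (intro close) auto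
      have 2: "\<bar>prob A - prob (r' A)\<bar> \<le> ?d A" using A Pev r'ev r'A by (intro close) auto
      have 3: "\<bar>prob B - prob (s' B)\<bar> \<le> ?e B" using B Qev s'ev s'B by (intro close) auto
      have "prob (r' A \<inter> s' B) - prob A * prob B
          = (prob (r' A) - prob A) * prob B + prob (r' A) * (prob (s' B) - prob B)"
        by (simp add: indep[OF A B] algebra_simps)
      also have "\<bar>\<dots>\<bar> \<le> \<bar>(prob (r' A) - prob A) * prob B\<bar> + \<bar>prob (r' A) * (prob (s' B) - prob B)\<bar>"
        by (rule abs_triangle_ineq)
      also have "\<dots> \<le> ?d A * prob B + prob (r' A) * ?e B"
        unfolding abs_mult using 2 3 by (intro add_mono mult_mono) (auto simp: abs_minus_commute)
      finally have 4: "\<bar>prob (r' A \<inter> s' B) - prob A * prob B\<bar> \<le> ?d A * prob B + prob (r' A) * ?e B" .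
      have eq: "A \<inter> B \<inter> N = B \<inter> (A \<inter> N)" "r' A \<inter> s' B \<inter> N = s' B \<inter> (r' A \<inter> N)" by auto
      have "\<bar>prob (A \<inter> B) - prob A * prob B\<bar>
          \<le> \<bar>prob (A \<inter> B) - prob (r' A \<inter> s' B)\<bar> + \<bar>prob (r' A \<inter> s' B) - prob A * prob B\<bar>"
        by linarith
      also note add_mono[OF 1[unfolded eq] 4]
      finally show ?thesis .
    qed
    have sumN: "(\<Sum>A\<in>P. prob (A \<inter> N)) \<le> prob N" "(\<Sum>A\<in>P. prob (r' A \<inter> N)) \<le> prob N"
      "(\<Sum>B\<in>Q. prob (B \<inter> N)) \<le> prob N" "(\<Sum>B\<in>Q. prob (s' B \<inter> N)) \<le> prob N"
      using sum_prob_disjoint_le[OF P(1) Pdis Pev N] sum_prob_disjoint_le[OF P(1) r'dis r'ev N]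
        sum_prob_disjoint_le[OF Q(1) Qdis Qev N] sum_prob_disjoint_le[OF Q(1) s'dis s'ev N] by auto
    have sum1: "(\<Sum>A\<in>P. prob (r' A)) \<le> 1" "(\<Sum>B\<in>Q. prob B) \<le> 1"
    proof -
      have "r' A \<inter> space M = r' A" for A by (auto simp: r'_def)
      then show "(\<Sum>A\<in>P. prob (r' A)) \<le> 1"
        using sum_prob_disjoint_le[OF P(1) r'dis r'ev sets.top] by (simp add: prob_space)
      have "B \<inter> space M = B" if "B \<in> Q" for B using Qev[OF that] sets.sets_into_space by auto
      then show "(\<Sum>B\<in>Q. prob B) \<le> 1"
        using sum_prob_disjoint_le[OF Q(1) Qdis Qev sets.top] by (simp add: prob_space)
    qed
    have "(\<Sum>A\<in>P. \<Sum>B\<in>Q. \<bar>prob (A \<inter> B) - prob A * prob B\<bar>)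
      \<le> (\<Sum>A\<in>P. \<Sum>B\<in>Q. (prob (B \<inter> (A \<inter> N)) + prob (s' B \<inter> (r' A \<inter> N)))
        + (?d A * prob B + prob (r' A) * ?e B))"
      by (intro sum_mono term_le)
    also have "\<dots> = (\<Sum>A\<in>P. (\<Sum>B\<in>Q. prob (B \<inter> (A \<inter> N))) + (\<Sum>B\<in>Q. prob (s' B \<inter> (r' A \<inter> N))))
        + ((\<Sum>A\<in>P. ?d A) * (\<Sum>B\<in>Q. prob B) + (\<Sum>A\<in>P. prob (r' A)) * (\<Sum>B\<in>Q. ?e B))"
      unfolding sum_product by (simp only: sum.distrib)
    \<comment> \<open>The joint law, the left marginals and the right marginals cost
      \<open>2 * prob N\<close> each; the factor 1/2 in \<open>beta_coeff\<close> turns the total 6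
      into 3.\<close>
    also have "\<dots> \<le> 2 * prob N + ((2 * prob N) * 1 + 1 * (2 * prob N))"
    proof (intro add_mono)
      have "(\<Sum>A\<in>P. (\<Sum>B\<in>Q. prob (B \<inter> (A \<inter> N))) + (\<Sum>B\<in>Q. prob (s' B \<inter> (r' A \<inter> N))))
          \<le> (\<Sum>A\<in>P. prob (A \<inter> N) + prob (r' A \<inter> N))"
        using Pev r'ev Qev s'ev
        by (intro sum_mono add_mono sum_prob_disjoint_le[OF Q(1) Qdis] sum_prob_disjoint_le[OF Q(1) s'dis]) auto
      also have "\<dots> \<le> 2 * prob N"
        using sumN by (simp add: sum.distrib)
      finally show "(\<Sum>A\<in>P. (\<Sum>B\<in>Q. prob (B \<inter> (A \<inter> N))) + (\<Sum>B\<in>Q. prob (s' B \<inter> (r' A \<inter> N))))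
          \<le> 2 * prob N" .
      show "(\<Sum>A\<in>P. ?d A) * (\<Sum>B\<in>Q. prob B) \<le> (2 * prob N) * 1"
        using sumN sum1 by (intro mult_mono) (auto simp: sum.distrib sum_nonneg)
      show "(\<Sum>A\<in>P. prob (r' A)) * (\<Sum>B\<in>Q. ?e B) \<le> 1 * (2 * prob N)"
        using sumN sum1 by (intro mult_mono) (auto simp: sum.distrib sum_nonneg)
    qed
    finally show ?thesis by simp
  qed
  have part: "partition_on (space M) {space M}"
    using not_empty by (auto simp: partition_on_def disjoint_def)
  have "Sup {\<Sum>A\<in>P. \<Sum>B\<in>Q. \<bar>prob (A \<inter> B) - prob A * prob B\<bar> | P Q.
     finite P \<and> P \<subseteq> \<A> \<and> partition_on (space M) P \<and>
     finite Q \<and> Q \<subseteq> \<B> \<and> partition_on (space M) Q} \<le> 6 * prob N" (is "Sup ?S \<le> _")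
  proof (rule cSup_least)
    have "(\<Sum>A\<in>{space M}. \<Sum>B\<in>{space M}. \<bar>prob (A \<inter> B) - prob A * prob B\<bar>) \<in> ?S"
      using part \<A>(2) \<B>(2) by blast
    then show "?S \<noteq> {}" by blast
  qed (use main in auto)
  then show ?thesis by (simp add: beta_coeff_def)
qed

text \<open>Points on which all generating variables agree cannot be separated, by induction over
  the generated algebra. This turns an identity of processes into the membership hypotheses of
  \<open>beta_coeff_le_coupling\<close>.\<close>

lemma generated_sigma_cong:
  assumes "A \<in> generated_sigma M X K" "\<omega> \<in> space M" "\<omega>' \<in> space M" "\<And>k. k \<in> K \<Longrightarrow> X k \<omega> = X k \<omega>'"
  shows "\<omega> \<in> A \<longleftrightarrow> \<omega>' \<in> A"
  using assms(1) unfolding generated_sigma_def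
proof induction
  case (Basic a)
  then show ?case using assms by auto
next
  case (Compl a)
  then show ?case using assms by auto
qed auto

lemma generated_sigma_subset:
  assumes "\<And>k. k \<in> K \<Longrightarrow> X k \<in> borel_measurable M"
  shows "generated_sigma M X K \<subseteq> sets M"
  unfolding generated_sigma_def
  by (rule sets.sigma_sets_subset) (use assms measurable_sets in blast)

section \<open>Restriction of a configuration to a set of sites\<close>

text \<open>The default value 1 means "no hit": hits lie strictly below a threshold that is at most
  1.\<close>

definition restrict_to :: "int set \<Rightarrow> (nat \<times> int \<Rightarrow> real) \<Rightarrow> nat \<times> int \<Rightarrow> real" where
  "restrict_to J \<omega> = (\<lambda>(a, i). if i \<in> J then \<omega> (a, i) else 1)"

lemma measurable_restrict_to [measurable]: "restrict_to J \<in> measurable pspace pspace"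
proof (rule measurable_to_pspace)
  show "(\<lambda>\<omega>. restrict_to J \<omega> i) \<in> borel_measurable pspace" for i
    by (cases "snd i \<in> J") (simp_all add: restrict_to_def split_beta)
qed

lemma indep_restrict_to:
  assumes "I \<inter> J = {}"
  shows "P.indep_var pspace (restrict_to I) pspace (restrict_to J)"
proof -
  let ?e = "\<lambda>K x. (\<lambda>(a, i). if i \<in> K then x (a, i) else 1) :: nat \<times> int \<Rightarrow> real"
  have meas: "?e K \<in> measurable (PiM (UNIV \<times> K) (\<lambda>_. borel)) pspace" for K
  proof (rule measurable_to_pspace)
    fix i :: "nat \<times> int"
    show "(\<lambda>x. ?e K x i) \<in> borel_measurable (PiM (UNIV \<times> K) (\<lambda>_. borel))"
      by (cases "snd i \<in> K") (auto simp: split_beta mem_Times_iff intro!: measurable_component_singleton)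
  qed
  have "P.indep_var (PiM (UNIV \<times> I) (\<lambda>_. borel)) (\<lambda>\<omega>. restrict (\<lambda>i. \<omega> i) (UNIV \<times> I))
      (PiM (UNIV \<times> J) (\<lambda>_. borel)) (\<lambda>\<omega>. restrict (\<lambda>i. \<omega> i) (UNIV \<times> J))"
    using assms by (intro P.indep_var_restrict[OF indep_coordinates]) auto
  from P.indep_var_compose[OF this meas meas]
  have "P.indep_var pspace (?e I \<circ> (\<lambda>\<omega>. restrict (\<lambda>i. \<omega> i) (UNIV \<times> I)))
      pspace (?e J \<circ> (\<lambda>\<omega>. restrict (\<lambda>i. \<omega> i) (UNIV \<times> J)))" .
  moreover have "?e K \<circ> (\<lambda>\<omega>. restrict (\<lambda>i. \<omega> i) (UNIV \<times> K)) = restrict_to K" for K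
    by (auto simp: restrict_to_def fun_eq_iff)
  ultimately show ?thesis by simp
qed

context tents
begin

lemma hit_restrict_to: "hit k i (restrict_to J \<omega>) \<longleftrightarrow> i \<in> J \<and> hit k i \<omega>"
proof -
  have "1 \<le> (real (L k))\<^sup>2" using L_pos[of k] by (simp add: one_le_power)
  then have "\<not> 1 < 1 / (real (L k))\<^sup>2" using L_pos[of k] by (simp add: not_less divide_le_eq_1)
  then show ?thesis by (auto simp: hit_def restrict_to_def)
qed

text \<open>\<open>f\<close> at site \<open>j\<close> sees the noise at \<open>j\<close> and the
  envelope at \<open>j\<close> and \<open>j + 1\<close>. Erasing sites is harmless as long as the
  tents covering these two points keep their centres.\<close>

lemma f_restrict_to:
  assumes "\<And>k i. hit k i \<omega> \<Longrightarrow> \<bar>i - j\<bar> < int (L k) \<or> \<bar>i - (j + 1)\<bar> < int (L k) \<Longrightarrow> i \<in> J" "j \<in> J"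
  shows "f (shift_by j (restrict_to J \<omega>)) = f (shift_by j \<omega>)"
proof -
  have "R h (shift_by l (restrict_to J \<omega>)) \<longleftrightarrow> R h (shift_by l \<omega>)" if "l = j \<or> l = j + 1" for l h
  proof -
    have "i \<in> J" if "hit k i \<omega>" "int h + \<bar>i - l\<bar> < int (L k)" for k i
      using assms(1)[OF that(1)] that(2) \<open>l = j \<or> l = j + 1\<close> by fastforce
    then show ?thesis unfolding R_shift_by hit_restrict_to by blast
  qed
  then have "g (shift_by j (restrict_to J \<omega>)) = g (shift_by j \<omega>)"
    "g (shift_by (j + 1) (restrict_to J \<omega>)) = g (shift_by (j + 1) \<omega>)"
    by (simp_all add: g_def)
  then show ?thesis using assms(2) by (simp add: f_shift_by restrict_to_def)
qed

text \<open>The past and the future can only interact through a tent that is higher than \<open>L k\<close>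
  at the midpoint of the gap.\<close>

lemma beta_mixing_f:
  "beta_mixing pspace (stationary_process pspace shift f) (2 * L k + 2) \<le> 12 / real (L (Suc k))"
proof -
  let ?X = "stationary_process pspace shift f"
  \<comment> \<open>The site \<open>c\<close> is \<open>L k\<close> away from site 1, the last one
    at which the past sees the envelope, and \<open>L k + 1\<close> away from the first site of the
    future.\<close>
  define c where "c = int (L k) + 1"
  define N where "N = {\<omega>. shift_by c \<omega> \<in> {\<omega>. R (L k) \<omega>}}"
  have N [measurable]: "N \<in> sets pspace"
    using measurable_sets[OF measurable_shift_by sets_R, of c "L k"] by (simp add: N_def vimage_def)
  have X: "?X j = (\<lambda>\<omega>. f (shift_by j \<omega>))" for j
    by (rule ext) (rule stationary_process_shift)
  have X_meas: "?X j \<in> borel_measurable pspace" for j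
    unfolding X by measurable
  \<comment> \<open>Off \<open>N\<close> no tent rises above \<open>L k\<close> at \<open>c\<close>.
    A tent centred beyond \<open>c\<close> has therefore come down to 0 after \<open>L k\<close>
    further steps and does not reach the other side.\<close>
  have far: "int (L k') \<le> int (L k) + \<bar>i - c\<bar>" if "\<omega> \<notin> N" "hit k' i \<omega>" for \<omega> k' i
    using that unfolding N_def mem_Collect_eq R_shift_by by force
  have past: "?X j \<omega> = ?X j (restrict_to {..c} \<omega>)" if "j \<in> {..0}" "\<omega> \<notin> N" for j \<omega>
    unfolding X
  proof (rule f_restrict_to[symmetric])
    fix k' i assume i: "hit k' i \<omega>" "\<bar>i - j\<bar> < int (L k') \<or> \<bar>i - (j + 1)\<bar> < int (L k')"
    show "i \<in> {..c}" using far[OF that(2) i(1)] i(2) that(1) unfolding c_def by auto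
  qed (use that in \<open>auto simp: c_def\<close>)
  have future: "?X j \<omega> = ?X j (restrict_to {c<..} \<omega>)" if "j \<in> {int (2 * L k + 2)..}" "\<omega> \<notin> N" for j \<omega>
    unfolding X
  proof (rule f_restrict_to[symmetric])
    fix k' i assume i: "hit k' i \<omega>" "\<bar>i - j\<bar> < int (L k') \<or> \<bar>i - (j + 1)\<bar> < int (L k')"
    show "i \<in> {c<..}" using far[OF that(2) i(1)] i(2) that(1) unfolding c_def by auto
  qed (use that in \<open>auto simp: c_def\<close>)
  have top: "space pspace \<in> generated_sigma pspace ?X K" for K
    unfolding generated_sigma_def by (rule sigma_sets_top)
  have "beta_mixing pspace ?X (2 * L k + 2) \<le> 3 * P.prob N"
    unfolding beta_mixing_def
  proof (rule P.beta_coeff_le_coupling[where r = "restrict_to {..c}" and s = "restrict_to {c<..}"])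
    show "restrict_to {..c} \<omega> \<in> A \<longleftrightarrow> \<omega> \<in> A"
      if "A \<in> generated_sigma pspace ?X {..0}" "\<omega> \<in> space pspace - N" for A \<omega>
      using past that(2) by (intro generated_sigma_cong[OF that(1)]) auto
    show "restrict_to {c<..} \<omega> \<in> B \<longleftrightarrow> \<omega> \<in> B"
      if "B \<in> generated_sigma pspace ?X {int (2 * L k + 2)..}" "\<omega> \<in> space pspace - N" for B \<omega>
      using future that(2) by (intro generated_sigma_cong[OF that(1)]) auto
    show "P.indep_var pspace (restrict_to {..c}) pspace (restrict_to {c<..})"
      by (rule indep_restrict_to) auto
  qed (use top generated_sigma_subset[OF X_meas] in auto)
  also have "P.prob N = P.prob {\<omega>. R (L k) \<omega>}"
    unfolding N_def by (rule prob_shift_by) (rule sets_R)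
  \<comment> \<open>Tents of scale at most \<open>k\<close> never exceed \<open>L k\<close>
    strictly, so the union bound starts at scale \<open>Suc k\<close>.\<close>
  also have "\<dots> \<le> 4 / real (L (Suc k))"
  proof (rule prob_R_le)
    show "L k' \<le> L k" if "k' < Suc k" for k'
      using that strict_mono_less_eq[OF L_strict, of k' k] by simp
  qed
  finally show ?thesis by simp
qed

end

section \<open>An oscillation functional\<close>

text \<open>Penalizing the distance of the two times, instead of bounding it, makes the oscillation
  Lipschitz continuous for the Skorohod metric.\<close>

definition osc_term :: "real \<Rightarrow> (real \<Rightarrow> real) \<Rightarrow> real \<times> real \<Rightarrow> real" where
  "osc_term K x p = \<bar>x (fst p) - x (snd p)\<bar> - K * \<bar>fst p - snd p\<bar>"

definition osc :: "real \<Rightarrow> (real \<Rightarrow> real) \<Rightarrow> real" where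
  "osc K x = (SUP p\<in>{0..1} \<times> {0..1}. osc_term K x p)"

text \<open>Weak convergence is tested on bounded functionals, hence the truncation.\<close>

definition trunc_osc :: "real \<Rightarrow> (real \<Rightarrow> real) \<Rightarrow> real" where
  "trunc_osc K x = min 1 (osc K x)"

definition bounded_path :: "(real \<Rightarrow> real) \<Rightarrow> bool" where
  "bounded_path x \<longleftrightarrow> (\<exists>B. \<forall>t\<in>{0..1}. \<bar>x t\<bar> \<le> B)"

lemma bounded_pathI: "(\<And>t. t \<in> {0..1} \<Longrightarrow> \<bar>x t\<bar> \<le> B) \<Longrightarrow> bounded_path x"
  unfolding bounded_path_def by blast

lemma bounded_pathE:
  assumes "bounded_path x" obtains B where "\<And>t. t \<in> {0..1} \<Longrightarrow> \<bar>x t\<bar> \<le> B"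
  using assms unfolding bounded_path_def by blast

lemma bdd_above_osc:
  assumes "bounded_path x" "K \<ge> 0"
  shows "bdd_above (osc_term K x ` ({0..1} \<times> {0..1}))"
proof -
  obtain B where B: "\<And>t. t \<in> {0..1} \<Longrightarrow> \<bar>x t\<bar> \<le> B" using assms(1) by (rule bounded_pathE) blast
  have "osc_term K x p \<le> 2 * B" if "p \<in> {0..1} \<times> {0..1}" for p
  proof -
    have "0 \<le> K * \<bar>fst p - snd p\<bar>" using assms(2) by simp
    moreover have "\<bar>x (fst p)\<bar> \<le> B" "\<bar>x (snd p)\<bar> \<le> B" using that by (auto intro!: B)
    ultimately show ?thesis unfolding osc_term_def by linarith
  qed
  then show ?thesis by (auto intro!: bdd_aboveI2)
qed

lemma osc_term_le_osc:
  assumes "bounded_path x" "K \<ge> 0" "s \<in> {0..1}" "t \<in> {0..1}"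
  shows "\<bar>x s - x t\<bar> - K * \<bar>s - t\<bar> \<le> osc K x"
proof -
  have "osc_term K x (s, t) \<le> osc K x"
    unfolding osc_def using assms by (intro cSUP_upper bdd_above_osc) auto
  then show ?thesis by (simp add: osc_term_def)
qed

lemma osc_le:
  assumes "\<And>s t. s \<in> {0..1} \<Longrightarrow> t \<in> {0..1} \<Longrightarrow> \<bar>x s - x t\<bar> - K * \<bar>s - t\<bar> \<le> C"
  shows "osc K x \<le> C"
  unfolding osc_def by (rule cSUP_least) (use assms in \<open>auto simp: osc_term_def\<close>)

lemma osc_nonneg:
  assumes "bounded_path x" "K \<ge> 0" shows "0 \<le> osc K x"
  using osc_term_le_osc[OF assms, of 0 0] by simp

text \<open>Each of the two times moves by at most \<open>d\<close>, which changes the penalty by at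
  most \<open>2 * K * d\<close>, and each of the two values moves by at most
  \<open>e\<close>.\<close>

lemma osc_le_time_change:
  assumes "bounded_path y" "K \<ge> 0"
    and r: "\<And>t. t \<in> {0..1} \<Longrightarrow> r t \<in> {0..1} \<and> \<bar>r t - t\<bar> \<le> d \<and> \<bar>x t - y (r t)\<bar> \<le> e"
  shows "osc K x \<le> osc K y + (2 * e + K * (2 * d))"
proof (rule osc_le)
  fix s t :: real assume st: "s \<in> {0..1}" "t \<in> {0..1}"
  have "\<bar>y (r s) - y (r t)\<bar> - K * \<bar>r s - r t\<bar> \<le> osc K y"
    using assms(1,2) r[OF st(1)] r[OF st(2)] by (intro osc_term_le_osc) auto
  moreover have "\<bar>x s - x t\<bar> \<le> \<bar>y (r s) - y (r t)\<bar> + 2 * e"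
    using r[OF st(1)] r[OF st(2)] by linarith
  moreover have "K * \<bar>r s - r t\<bar> \<le> K * (\<bar>s - t\<bar> + 2 * d)"
    using r[OF st(1)] r[OF st(2)] assms(2) by (intro mult_left_mono) linarith+
  ultimately show "\<bar>x s - x t\<bar> - K * \<bar>s - t\<bar> \<le> osc K y + (2 * e + K * (2 * d))"
    by (simp add: algebra_simps)
qed

lemma trunc_osc_bounds:
  assumes "bounded_path x" "K \<ge> 0" shows "0 \<le> trunc_osc K x" "trunc_osc K x \<le> 1"
  using osc_nonneg[OF assms] by (auto simp: trunc_osc_def)

lemma trunc_osc_diff_le:
  "osc K x \<le> osc K y + e \<Longrightarrow> osc K y \<le> osc K x + e \<Longrightarrow> \<bar>trunc_osc K x - trunc_osc K y\<bar> \<le> e"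
  by (auto simp: trunc_osc_def min_def)

lemma trunc_osc_sup_norm:
  assumes "bounded_path x" "bounded_path y" "K \<ge> 0" "\<And>t. t \<in> {0..1} \<Longrightarrow> \<bar>x t - y t\<bar> \<le> e"
  shows "\<bar>trunc_osc K x - trunc_osc K y\<bar> \<le> 2 * e"
proof (rule trunc_osc_diff_le)
  show "osc K x \<le> osc K y + 2 * e"
    using osc_le_time_change[OF assms(2,3), of "\<lambda>t. t" 0 x e] assms(4) by auto
  show "osc K y \<le> osc K x + 2 * e"
    using osc_le_time_change[OF assms(1,3), of "\<lambda>t. t" 0 y e] assms(4) by (auto simp: abs_minus_commute)
qed

section \<open>Path spaces on which the functional is Lipschitz\<close>

text \<open>What the argument needs of a path space, so that it runs once for both. The constant is
  that of \<open>osc_le_time_change\<close> with \<open>d = e\<close>, as the Skorohod metric bounds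
  both displacements by the same number.\<close>

locale path_metric =
  fixes m :: "(real \<Rightarrow> real) metric"
  assumes path_bounded: "x \<in> mspace m \<Longrightarrow> bounded_path x"
    and trunc_osc_lipschitz: "K \<ge> 0 \<Longrightarrow> x \<in> mspace m \<Longrightarrow> y \<in> mspace m \<Longrightarrow>
      \<bar>trunc_osc K x - trunc_osc K y\<bar> \<le> (2 + 2 * K) * mdist m x y"
begin

lemma continuous_trunc_osc:
  assumes "K \<ge> 0" shows "continuous_map (mtopology_of m) euclideanreal (trunc_osc K)"
proof -
  have "Lipschitz_continuous_map m euclidean_metric (trunc_osc K)"
    unfolding Lipschitz_continuous_map_def
    using trunc_osc_lipschitz[OF assms] by (auto simp: dist_real_def)
  then show ?thesis
    using Lipschitz_continuous_imp_continuous_map by fastforce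
qed

lemma bounded_trunc_osc:
  assumes "K \<ge> 0" shows "bounded (trunc_osc K ` mspace m)"
  unfolding bounded_iff
  using trunc_osc_bounds[OF path_bounded assms] by (intro exI[of _ 1]) auto

lemma trunc_osc_measurable:
  assumes "wiener_measure_on m \<nu>" "K \<ge> 0"
  shows "trunc_osc K \<in> borel_measurable \<nu>"
proof (rule borel_measurableI)
  fix S :: "real set" assume "open S"
  then have "openin (mtopology_of m) {x \<in> topspace (mtopology_of m). trunc_osc K x \<in> S}"
    using continuous_trunc_osc[OF assms(2)] by (auto simp: continuous_map_def)
  moreover have "trunc_osc K -` S \<inter> space \<nu> = {x \<in> topspace (mtopology_of m). trunc_osc K x \<in> S}"
    using assms(1) by (auto simp: wiener_measure_on_def)
  ultimately show "trunc_osc K -` S \<inter> space \<nu> \<in> sets \<nu>"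
    using assms(1) by (auto simp: wiener_measure_on_def)
qed

end

text \<open>Close pairs of times contribute little by uniform continuity; for pairs at distance at
  least \<open>d\<close> the penalty \<open>K * d\<close> eventually reaches the maximal oscillation
  \<open>2 * B\<close>.\<close>

lemma osc_tendsto_0:
  assumes "continuous_on {0..1} x"
  shows "(\<lambda>K. osc (real K) x) \<longlonglongrightarrow> 0"
proof -
  have "compact (x ` {0..1})" using assms by (intro compact_continuous_image) auto
  then obtain B where B: "\<And>t. t \<in> {0..1} \<Longrightarrow> \<bar>x t\<bar> \<le> B"
    using compact_imp_bounded by (fastforce simp: bounded_iff)
  then have bp: "bounded_path x" by (rule bounded_pathI)
  have B0: "B \<ge> 0" using B[of 0] by auto
  have uc: "uniformly_continuous_on {0..1} x"
    using assms by (intro compact_uniformly_continuous) auto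
  show ?thesis
  proof (rule LIMSEQ_I)
    fix e :: real assume e: "e > 0"
    obtain d where d: "d > 0" "\<And>s t. s \<in> {0..1} \<Longrightarrow> t \<in> {0..1} \<Longrightarrow> dist s t < d \<Longrightarrow> dist (x s) (x t) < e / 2"
      using uc e unfolding uniformly_continuous_on_def by (metis half_gt_zero dist_commute)
    have le: "osc (real K) x \<le> e / 2" if K: "real K \<ge> 2 * B / d" for K
    proof (rule osc_le)
      fix s t :: real assume st: "s \<in> {0..1}" "t \<in> {0..1}"
      show "\<bar>x s - x t\<bar> - real K * \<bar>s - t\<bar> \<le> e / 2"
      proof (cases "\<bar>s - t\<bar> < d")
        case True
        then have "\<bar>x s - x t\<bar> < e / 2" using d(2)[OF st] by (simp add: dist_real_def)
        moreover have "0 \<le> real K * \<bar>s - t\<bar>" by simp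
        ultimately show ?thesis by linarith
      next
        case False
        have "2 * B = 2 * B / d * d" using d(1) by simp
        also have "\<dots> \<le> real K * \<bar>s - t\<bar>" using K False B0 d(1) by (intro mult_mono) auto
        finally show ?thesis using B[OF st(1)] B[OF st(2)] e by linarith
      qed
    qed
    show "\<exists>no. \<forall>n\<ge>no. norm (osc (real n) x - 0) < e"
    proof (intro exI[of _ "nat \<lceil>2 * B / d\<rceil>"] allI impI)
      fix n assume "nat \<lceil>2 * B / d\<rceil> \<le> n"
      then have "real n \<ge> 2 * B / d" by linarith
      then show "norm (osc (real n) x - 0) < e"
        using le[of n] osc_nonneg[OF bp, of "real n"] e by simp
    qed
  qed
qed

lemma (in path_metric) wiener_trunc_osc_tendsto_0:
  assumes \<nu>: "wiener_measure_on m \<nu>"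
  shows "(\<lambda>K. \<integral>x. trunc_osc (real K) x \<partial>\<nu>) \<longlonglongrightarrow> 0"
proof -
  interpret N: prob_space \<nu> using \<nu> by (simp add: wiener_measure_on_def brownian_motion01_def)
  have "AE x in \<nu>. continuous_on {0..1} x"
    using \<nu> by (simp add: wiener_measure_on_def brownian_motion01_def)
  then have lim: "AE x in \<nu>. (\<lambda>K. trunc_osc (real K) x) \<longlonglongrightarrow> 0"
  proof eventually_elim
    case (elim x)
    then have "(\<lambda>K. min 1 (osc (real K) x)) \<longlonglongrightarrow> min 1 0"
      by (intro tendsto_min tendsto_const osc_tendsto_0)
    then show ?case by (simp add: trunc_osc_def)
  qed
  have "(\<lambda>K. \<integral>x. trunc_osc (real K) x \<partial>\<nu>) \<longlonglongrightarrow> (\<integral>x. 0 \<partial>\<nu>)"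
  proof (rule integral_dominated_convergence[where w = "\<lambda>_. 1"])
    show "trunc_osc (real K) \<in> borel_measurable \<nu>" for K
      by (rule trunc_osc_measurable[OF \<nu>]) simp
    have "space \<nu> = mspace m" using \<nu> by (simp add: wiener_measure_on_def)
    then show "AE x in \<nu>. norm (trunc_osc (real K) x) \<le> 1" for K
      using trunc_osc_bounds[OF path_bounded, of _ "real K"] by (intro AE_I2) auto
  qed (use lim in auto)
  then show ?thesis by simp
qed

text \<open>For a limit law some \<open>K\<close> would make its mean truncated oscillation smaller
  than \<open>\<delta>\<close>, and weak convergence would eventually push the means along the
  sequence below \<open>\<delta>\<close>. A lower bound for infinitely many \<open>n\<close>
  contradicts this.\<close>

lemma (in path_metric) not_converges_weakly:
  assumes low: "\<And>K :: nat. K \<ge> 1 \<Longrightarrow> \<exists>\<^sub>F n in sequentially. \<delta> \<le> (\<integral>\<omega>. trunc_osc (real K) (X n \<omega>) \<partial>M)"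
    and "\<delta> > 0"
  shows "\<not> (\<exists>\<nu>. wiener_measure_on m \<nu> \<and> converges_weakly M m X \<nu>)"
proof
  assume "\<exists>\<nu>. wiener_measure_on m \<nu> \<and> converges_weakly M m X \<nu>"
  then obtain \<nu> where \<nu>: "wiener_measure_on m \<nu>" "converges_weakly M m X \<nu>" by blast
  have "\<forall>\<^sub>F K in sequentially. (\<integral>x. trunc_osc (real K) x \<partial>\<nu>) < \<delta>"
    using wiener_trunc_osc_tendsto_0[OF \<nu>(1)] \<open>\<delta> > 0\<close> by (rule order_tendstoD(2))
  then obtain K0 where "\<And>K. K \<ge> K0 \<Longrightarrow> (\<integral>x. trunc_osc (real K) x \<partial>\<nu>) < \<delta>"
    by (auto simp: eventually_sequentially)
  then obtain K where K: "K \<ge> 1" "(\<integral>x. trunc_osc (real K) x \<partial>\<nu>) < \<delta>"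
    by (metis max.cobounded1 max.cobounded2)
  have "(\<lambda>n. \<integral>\<omega>. trunc_osc (real K) (X n \<omega>) \<partial>M) \<longlonglongrightarrow> (\<integral>x. trunc_osc (real K) x \<partial>\<nu>)"
    using \<nu>(2) continuous_trunc_osc[of "real K"] bounded_trunc_osc[of "real K"]
    unfolding converges_weakly_def by simp
  then have "\<forall>\<^sub>F n in sequentially. (\<integral>\<omega>. trunc_osc (real K) (X n \<omega>) \<partial>M) < \<delta>"
    using K(2) by (rule order_tendstoD(2))
  then have "\<forall>\<^sub>F n in sequentially. \<not> \<delta> \<le> (\<integral>\<omega>. trunc_osc (real K) (X n \<omega>) \<partial>M)"
    by (simp add: not_le)
  with low[OF K(1)] show False by (simp add: frequently_def)
qed

section \<open>The two concrete path spaces\<close>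

lemma path_metric_C01: "path_metric C01"
proof
  show bp: "bounded_path z" if "z \<in> mspace C01" for z
  proof -
    have "Metric_space.mbounded UNIV dist (z ` {0..1})" using that by (simp add: C01_def)
    then have "bounded (z ` {0..1})" by simp
    then show "bounded_path z" by (auto simp: bounded_path_def bounded_iff)
  qed
  fix K :: real and x y assume K: "K \<ge> 0" and x: "x \<in> mspace C01" and y: "y \<in> mspace C01"
  have "\<bar>x t - y t\<bar> \<le> mdist C01 x y" if "t \<in> {0..1}" for t
    using mdist_cfunspace_imp_mdist_le[OF x[unfolded C01_def] y[unfolded C01_def] order_refl, of t] that
    by (simp add: C01_def dist_real_def)
  then have "\<bar>trunc_osc K x - trunc_osc K y\<bar> \<le> 2 * mdist C01 x y"
    using bp x y K by (intro trunc_osc_sup_norm) auto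
  also have "\<dots> \<le> (2 + 2 * K) * mdist C01 x y" using K by (intro mult_right_mono) auto
  finally show "\<bar>trunc_osc K x - trunc_osc K y\<bar> \<le> (2 + 2 * K) * mdist C01 x y" .
qed

lemma path_metric_D01: "path_metric D01"
proof
  fix x assume "x \<in> mspace D01"
  then show "bounded_path x" using cadlag01_bounded[of x] bounded_pathI mspace_D01 by metis
next
  fix K :: real and x y assume K: "K \<ge> 0" and x: "x \<in> mspace D01" and y: "y \<in> mspace D01"
  have one_sided: "osc K z \<le> osc K w + (2 + 2 * K) * e"
    if w: "w \<in> cadlag01" and e: "e \<in> skorohod_bounds z w" for z w e
  proof -
    obtain r where r: "r \<in> time_changes" "\<And>t. t \<in> {0..1} \<Longrightarrow> \<bar>r t - t\<bar> \<le> e \<and> \<bar>z t - w (r t)\<bar> \<le> e"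
      using e by (auto simp: skorohod_bounds_def)
    have "bounded_path w" using cadlag01_bounded[OF w] bounded_pathI by metis
    from osc_le_time_change[OF this K, of r e z e] r time_changes_mem[OF r(1)]
    show ?thesis by (simp add: algebra_simps)
  qed
  \<comment> \<open>Dividing by the constant lets the estimate pass to the infimum over all
    admissible \<open>e\<close>.\<close>
  have "\<bar>trunc_osc K x - trunc_osc K y\<bar> / (2 + 2 * K) \<le> e" if e: "e \<in> skorohod_bounds x y" for e
  proof -
    have "e \<in> skorohod_bounds y x" using e skorohod_bounds_sym by blast
    then have "\<bar>trunc_osc K x - trunc_osc K y\<bar> \<le> (2 + 2 * K) * e"
      using one_sided[OF _ e] one_sided[of x e y] x y by (intro trunc_osc_diff_le) auto
    then show ?thesis using K by (simp add: field_simps)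
  qed
  then have "\<bar>trunc_osc K x - trunc_osc K y\<bar> / (2 + 2 * K) \<le> Inf (skorohod_bounds x y)"
    using x y by (intro cInf_greatest skorohod_bounds_nonempty) auto
  then show "\<bar>trunc_osc K x - trunc_osc K y\<bar> \<le> (2 + 2 * K) * mdist D01 x y"
    using x y K by (simp add: skorohod_dist_def field_simps)
qed

section \<open>Failure of the invariance principle\<close>

text \<open>The interpolated path for \<open>b = 1\<close> and the step path for \<open>b = 0\<close>.\<close>

definition gpath :: "real \<Rightarrow> nat \<Rightarrow> (nat \<Rightarrow> real) \<Rightarrow> real \<Rightarrow> real" where
  "gpath b n v = (\<lambda>t\<in>{0..1}. ((\<Sum>j<nat \<lfloor>real n * t\<rfloor>. v j)
     + b * (real n * t - of_int \<lfloor>real n * t\<rfloor>) * v (nat \<lfloor>real n * t\<rfloor>)) / sqrt (real n))"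

lemma interpolated_path_eq_gpath:
  "interpolated_path T f (\<lambda>n. sqrt (real n)) n \<omega> = gpath 1 n (\<lambda>j. f ((T ^^ j) \<omega>))"
  by (simp add: interpolated_path_def gpath_def psum_def)

lemma step_path_eq_gpath:
  "step_path T f (\<lambda>n. sqrt (real n)) n \<omega> = gpath 0 n (\<lambda>j. f ((T ^^ j) \<omega>))"
  by (simp add: step_path_def gpath_def psum_def)

lemma gpath_at_grid:
  assumes "0 < n" "i \<le> n"
  shows "gpath b n v (real i / real n) = (\<Sum>j<i. v j) / sqrt (real n)"
  using assms by (simp add: gpath_def)

text \<open>The sum includes the index \<open>n\<close> because at \<open>t = 1\<close> the formula
  refers to \<open>v n\<close>. Comparison with the zero sequence also yields boundedness of the
  paths.\<close>

lemma gpath_diff_le: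
  assumes b: "0 \<le> b" "b \<le> 1" and t: "t \<in> {0..1}"
  shows "\<bar>gpath b n v t - gpath b n w t\<bar> \<le> (\<Sum>j\<le>n. \<bar>v j - w j\<bar>) / sqrt (real n)"
proof -
  define i where "i = nat \<lfloor>real n * t\<rfloor>"
  define \<theta> where "\<theta> = b * (real n * t - of_int \<lfloor>real n * t\<rfloor>)"
  have "real n * t \<le> real n" using t mult_left_mono[of t 1 "real n"] by simp
  then have "i \<le> n" unfolding i_def by linarith
  have "0 \<le> real n * t - of_int \<lfloor>real n * t\<rfloor>" "real n * t - of_int \<lfloor>real n * t\<rfloor> \<le> 1" by linarith+
  then have \<theta>: "0 \<le> \<theta>" "\<theta> \<le> 1" unfolding \<theta>_def using b by (auto intro: mult_le_one)
  have "\<bar>((\<Sum>j<i. v j) + \<theta> * v i) - ((\<Sum>j<i. w j) + \<theta> * w i)\<bar> = \<bar>(\<Sum>j<i. v j - w j) + \<theta> * (v i - w i)\<bar>"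
    by (simp add: sum_subtractf algebra_simps)
  also have "\<dots> \<le> \<bar>\<Sum>j<i. v j - w j\<bar> + \<bar>\<theta> * (v i - w i)\<bar>" by (rule abs_triangle_ineq)
  also have "\<dots> \<le> (\<Sum>j<i. \<bar>v j - w j\<bar>) + 1 * \<bar>v i - w i\<bar>"
    unfolding abs_mult using \<theta> by (intro add_mono sum_abs mult_right_mono) auto
  also have "\<dots> = (\<Sum>j\<le>i. \<bar>v j - w j\<bar>)" by (simp add: lessThan_Suc_atMost[symmetric])
  also have "\<dots> \<le> (\<Sum>j\<le>n. \<bar>v j - w j\<bar>)" using \<open>i \<le> n\<close> by (intro sum_mono2) auto
  finally have "\<bar>((\<Sum>j<i. v j) + \<theta> * v i) - ((\<Sum>j<i. w j) + \<theta> * w i)\<bar> / sqrt (real n)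
      \<le> (\<Sum>j\<le>n. \<bar>v j - w j\<bar>) / sqrt (real n)"
    by (rule divide_right_mono) simp
  then show ?thesis
    using t by (simp add: gpath_def i_def[symmetric] \<theta>_def[symmetric] diff_divide_distrib[symmetric])
qed

lemma bounded_gpath:
  assumes "0 \<le> b" "b \<le> 1" shows "bounded_path (gpath b n v)"
proof (rule bounded_pathI)
  fix t :: real assume t: "t \<in> {0..1}"
  show "\<bar>gpath b n v t\<bar> \<le> (\<Sum>j\<le>n. \<bar>v j\<bar>) / sqrt (real n)"
    using gpath_diff_le[OF assms t, of n v "\<lambda>_. 0"] t by (simp add: gpath_def)
qed

text \<open>This serves measurability: \<open>osc\<close> is a supremum over uncountably many pairs
  of times, but it depends continuously on the finitely many values that determine the path.\<close>

lemma continuous_trunc_osc_gpath: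
  assumes b: "0 \<le> b" "b \<le> 1" and K: "K \<ge> 0"
  shows "continuous_on UNIV (\<lambda>v. trunc_osc K (gpath b n v))"
  unfolding continuous_on_def
proof
  fix w :: "nat \<Rightarrow> real"
  let ?d = "\<lambda>v. 2 * ((\<Sum>j\<le>n. \<bar>v j - w j\<bar>) / sqrt (real n))"
  have "continuous_on UNIV ?d"
    by (cases "n = 0") (auto intro!: continuous_intros continuous_on_product_coordinates)
  then have "(?d \<longlongrightarrow> ?d w) (at w)" unfolding continuous_on_def by blast
  then have lim: "(?d \<longlongrightarrow> 0) (at w)" by simp
  have "((\<lambda>v. trunc_osc K (gpath b n v) - trunc_osc K (gpath b n w)) \<longlongrightarrow> 0) (at w)"
  proof (rule Lim_null_comparison[OF _ lim])
    show "\<forall>\<^sub>F v in at w. norm (trunc_osc K (gpath b n v) - trunc_osc K (gpath b n w)) \<le> ?d v"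
      using trunc_osc_sup_norm[OF bounded_gpath[OF b] bounded_gpath[OF b] K gpath_diff_le[OF b]] by simp
  qed
  then show "((\<lambda>v. trunc_osc K (gpath b n v)) \<longlongrightarrow> trunc_osc K (gpath b n w)) (at w)"
    by (simp add: LIM_zero_iff)
qed

section \<open>Probability of a macroscopic dip in the sample paths\<close>

context tents
begin

definition fpath :: "real \<Rightarrow> nat \<Rightarrow> (nat \<times> int \<Rightarrow> real) \<Rightarrow> real \<Rightarrow> real" where
  "fpath b n \<omega> = gpath b n (\<lambda>j. f (shift_by (int j) \<omega>))"

lemma measurable_trunc_osc_fpath:
  assumes "0 \<le> b" "b \<le> 1" "K \<ge> 0"
  shows "(\<lambda>\<omega>. trunc_osc K (fpath b n \<omega>)) \<in> borel_measurable pspace"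
proof -
  have "(\<lambda>\<omega> j. f (shift_by (int j) \<omega>)) \<in> borel_measurable pspace"
    by (rule measurable_coordinatewise_then_product) measurable
  from measurable_compose[OF this borel_measurable_continuous_onI[OF continuous_trunc_osc_gpath[OF assms]]]
  show ?thesis unfolding fpath_def .
qed

lemma prob_no_hit: "P.prob {\<omega>. \<forall>j<n. \<not> hit k (int j) \<omega>} = (1 - 1 / (real (L k))\<^sup>2) ^ n"
proof -
  let ?p = "1 / (real (L k))\<^sup>2" and ?J = "(\<lambda>j. (Suc k, int j)) ` {..<n}"
  have "{\<omega>. \<forall>j<n. \<not> hit k (int j) \<omega>} = (\<Inter>i\<in>?J. (\<lambda>\<omega>. \<omega> i) -` {?p..} \<inter> space pspace)" if "n > 0"
    using that by (auto simp: hit_def not_less)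
  moreover have "P.prob (\<Inter>i\<in>?J. (\<lambda>\<omega>. \<omega> i) -` {?p..} \<inter> space pspace)
      = (\<Prod>i\<in>?J. P.prob ((\<lambda>\<omega>. \<omega> i) -` {?p..} \<inter> space pspace))" if "n > 0"
    using that by (intro P.indep_varsD[OF indep_coordinates]) auto
  moreover have "P.prob ((\<lambda>\<omega>. \<omega> i) -` {?p..} \<inter> space pspace) = 1 - ?p" if "i \<in> ?J" for i
  proof -
    from that obtain j where i: "i = (Suc k, int j)" by auto
    have "(\<lambda>\<omega>. \<omega> i) -` {?p..} \<inter> space pspace = space pspace - {\<omega>. hit k (int j) \<omega>}"
      by (auto simp: i hit_def)
    moreover have "{\<omega>. hit k (int j) \<omega>} \<in> sets pspace"
      using measurable_hit by (simp add: pred_def)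
    ultimately show ?thesis using P.prob_compl prob_hit by simp
  qed
  moreover have "card ?J = n" by (subst card_image) (auto simp: inj_on_def)
  ultimately show ?thesis
    by (cases "n = 0") (auto simp: P.prob_space[simplified])
qed

text \<open>There are \<open>n = (L k)^2\<close> independent sites with hit probability
  \<open>1 / n\<close> each, and \<open>(1 - 1 / n)^n\<close> is at most
  \<open>exp (- 1)\<close>.\<close>

lemma prob_no_hit_le: "P.prob {\<omega>. \<forall>j<(L k)\<^sup>2. \<not> hit k (int j) \<omega>} \<le> 1 / 2"
proof -
  let ?p = "1 / (real (L k))\<^sup>2" and ?n = "(L k)\<^sup>2"
  have p: "?p \<le> 1" using L_pos[of k] by (simp add: one_le_power)
  have "(1 - ?p) ^ ?n \<le> exp (- ?p) ^ ?n"
    using p exp_ge_add_one_self[of "- ?p"] by (intro power_mono) auto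
  also have "\<dots> = exp (- 1)"
    using L_pos[of k] by (simp add: exp_of_nat_mult[symmetric])
  also have "\<dots> \<le> 1 / 2"
    using exp_ge_add_one_self[of 1] by (simp add: exp_minus field_simps)
  finally show ?thesis by (simp add: prob_no_hit)
qed

text \<open>The sign flip leaves the tents unchanged and reverses the Gaussian increments, so in at least
  one of the two paths the Gaussian increment does not compensate the tent.\<close>

lemma trunc_osc_fpath_flip:
  fixes K k :: nat
  assumes b: "0 \<le> b" "b \<le> 1" and K: "K \<ge> 1" and n: "n = (L k)\<^sup>2" "n \<ge> 4 * K"
    and q: "q = n div (4 * K)"
    and hit: "j < n" "hit k (int j) \<omega>"
    and low: "\<And>l. l \<le> 8 * K \<Longrightarrow> \<not> R (L k div 4) (shift_by (int (q * l)) \<omega>)"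
  shows "1 / 2 \<le> trunc_osc (real K) (fpath b n \<omega>) + trunc_osc (real K) (fpath b n (flip \<omega>))"
proof -
  \<comment> \<open>The last multiple of \<open>q\<close> not after \<open>j\<close>. The spacing
    \<open>q\<close> is at most \<open>n / (4 * K)\<close>, so the time penalty between
    \<open>i\<close> and \<open>j\<close> is at most 1/4.\<close>
  define i where "i = q * (j div q)"
  have q0: "q > 0" using n(2) K by (simp add: q div_greater_zero_iff)
  have n0: "n > 0" using n(2) K by linarith
  have sq: "sqrt (real n) = real (L k)" by (simp add: n(1))
  have Lk: "real (L k) > 0" using L_pos by simp
  \<comment> \<open>Since \<open>q\<close> is at least 1, \<open>n < 4 * K * (q + 1)\<close> gives
    \<open>n < 8 * K * q\<close>: the grid indices up to \<open>8 * K\<close> cover all sites below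
    \<open>n\<close>.\<close>
  have "j div q \<le> 8 * K"
  proof -
    have "n < 4 * K * q + 4 * K" using dividend_less_div_times[of "4 * K" n] K
      unfolding q by (simp add: algebra_simps)
    also have "\<dots> \<le> 4 * K * q + 4 * K * q" using q0 by simp
    finally have "j < (8 * K) * q" using hit(1) by simp
    then show ?thesis by (simp add: less_mult_imp_div_less less_imp_le)
  qed
  then have "\<not> R (L k div 4) (shift_by (int i) \<omega>)" using low by (simp add: i_def)
  then have "g (shift_by (int i) \<omega>) \<le> L k div 4" using less_g_imp_R not_less by blast
  then have gi: "real (g (shift_by (int i) \<omega>)) \<le> real (L k) / 4" by linarith
  \<comment> \<open>The origin is a grid point too; its bound rules out the unspecified value of
    \<open>g\<close>, so the hit at \<open>j\<close> does force height \<open>L k\<close>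
    there.\<close>
  have "\<not> R (L k div 4) \<omega>" using low[of 0] by simp
  then have gj: "real (L k) \<le> real (g (shift_by (int j) \<omega>))"
    using hit_imp_g_ge[OF _ hit(2)] by simp
  have ij: "i \<le> j" "j - i < q"
    using q0 by (simp_all add: i_def minus_mult_div_eq_mod)
  have psum_val: "(\<Sum>l<i. f (shift_by (int l) \<omega>')) = gsum i \<omega>' + D i \<omega>'" for i \<omega>'
    using psum_eq[of i \<omega>'] by (simp add: psum_def shift_funpow)
  define G where "G = gsum j \<omega> - gsum i \<omega>"
  define d where "d = real (g (shift_by (int j) \<omega>)) - real (g (shift_by (int i) \<omega>))"
  have d: "d \<ge> 3 / 4 * real (L k)" using gi gj by (simp add: d_def)
  have incr: "fpath b n \<omega>' (real j / real n) - fpath b n \<omega>' (real i / real n)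
      = ((gsum j \<omega>' - gsum i \<omega>') + (D j \<omega>' - D i \<omega>')) / real (L k)" for \<omega>'
    using n0 hit(1) ij(1)
    by (simp add: fpath_def gpath_at_grid psum_val sq diff_divide_distrib add_divide_distrib)
  have time: "real K * \<bar>real j / real n - real i / real n\<bar> \<le> 1 / 4"
  proof -
    have "q * (4 * K) \<le> n" unfolding q by (rule div_times_less_eq_dividend)
    then have "4 * (K * (j - i)) \<le> n"
      using ij(2) mult_le_mono2[of "j - i" q "4 * K"] by (simp add: algebra_simps)
    then have "4 * (real K * (real j - real i)) \<le> real n"
      using ij(1) by (simp flip: of_nat_diff of_nat_mult)
    moreover have "\<bar>real j / real n - real i / real n\<bar> = (real j - real i) / real n"
      using ij(1) by (simp add: diff_divide_distrib[symmetric])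
    ultimately show ?thesis using n0 by (simp add: field_simps)
  qed
  have osc_ge: "\<bar>(gsum j \<omega>' - gsum i \<omega>') + (D j \<omega>' - D i \<omega>')\<bar> / real (L k) - 1 / 4 \<le> osc (real K) (fpath b n \<omega>')" for \<omega>'
  proof -
    have bp: "bounded_path (fpath b n \<omega>')" unfolding fpath_def by (rule bounded_gpath[OF b])
    have "\<bar>fpath b n \<omega>' (real j / real n) - fpath b n \<omega>' (real i / real n)\<bar>
        - real K * \<bar>real j / real n - real i / real n\<bar> \<le> osc (real K) (fpath b n \<omega>')"
      using hit(1) ij(1) by (intro osc_term_le_osc[OF bp]) auto
    then show ?thesis using time Lk by (simp add: incr abs_divide)
  qed
  have Dij: "D j \<omega> - D i \<omega> = - d" by (simp add: D_def d_def)
  \<comment> \<open>A noise increment of the sign that deepens the dip leaves a drop of 3/4 in units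
    of \<open>L k\<close>, and 3/4 - 1/4 = 1/2 remains after the penalty.\<close>
  have large: "1 / 2 \<le> \<bar>x - d\<bar> / real (L k) - 1 / 4" if "x \<le> 0" for x
  proof -
    have "3 / 4 * real (L k) \<le> \<bar>x - d\<bar>" using that d Lk by linarith
    then show ?thesis using Lk by (simp add: field_simps)
  qed
  have "1 / 2 \<le> osc (real K) (fpath b n \<omega>) \<or> 1 / 2 \<le> osc (real K) (fpath b n (flip \<omega>))"
  proof (cases "G \<le> 0")
    case True
    then show ?thesis using osc_ge[of \<omega>] large[of G] by (simp add: Dij flip: G_def)
  next
    case False
    have "\<bar>- G - d\<bar> / real (L k) - 1 / 4 \<le> osc (real K) (fpath b n (flip \<omega>))"
      using osc_ge[of "flip \<omega>"] by (simp add: Dij G_def)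
    then show ?thesis using large[of "- G"] False by linarith
  qed
  moreover have nonneg: "0 \<le> trunc_osc (real K) (fpath b n \<omega>')" for \<omega>'
    unfolding fpath_def by (rule trunc_osc_bounds[OF bounded_gpath[OF b]]) simp
  moreover have "1 / 2 \<le> osc (real K) x \<Longrightarrow> 1 / 2 \<le> trunc_osc (real K) x" for x
    by (simp add: trunc_osc_def)
  ultimately consider "1 / 2 \<le> trunc_osc (real K) (fpath b n \<omega>)"
    | "1 / 2 \<le> trunc_osc (real K) (fpath b n (flip \<omega>))" by blast
  then show ?thesis
    by cases (use nonneg[of \<omega>] nonneg[of "flip \<omega>"] in linarith)+
qed

text \<open>With probability at least 1 - 1/2 - 1/4 = 1/4 some site below \<open>n\<close> is hit at
  scale \<open>k\<close> while the envelope is low at all grid points. On this event a path and its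
  flip together contribute 1/2, so twice the mean is at least 1/8.\<close>

lemma trunc_osc_fpath_frequently:
  fixes K :: nat
  assumes b: "0 \<le> b" "b \<le> 1" and K: "K \<ge> 1"
  shows "\<exists>\<^sub>F n in sequentially. 1 / 16 \<le> (\<integral>\<omega>. trunc_osc (real K) (fpath b n \<omega>) \<partial>pspace)"
  unfolding frequently_sequentially
proof
  fix N :: nat
  \<comment> \<open>The first entry pushes \<open>n\<close> beyond \<open>N\<close>; the second
    makes \<open>8 * K + 1\<close> bad events of probability at most \<open>16 / L k\<close> add up
    to at most 1/4.\<close>
  define k where "k = max N (64 * (8 * K + 1))"
  define n where "n = (L k)\<^sup>2"
  define q where "q = n div (4 * K)"
  define h where "h = L k div 4"
  define B where "B l = {\<omega>. shift_by (int (q * l)) \<omega> \<in> {\<omega>. R h \<omega>}}" for l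
  define U where "U = {\<omega>. \<forall>j<(L k)\<^sup>2. \<not> hit k (int j) \<omega>}"
  define A where "A = space pspace - (U \<union> (\<Union>l\<in>{..8 * K}. B l))"
  have "L k \<le> n" unfolding n_def by (simp add: power2_eq_square)
  have kL: "k < L k" by (rule L_ge)
  have nN: "N \<le> n" and nK: "4 * K \<le> n" using kL \<open>L k \<le> n\<close> by (auto simp: k_def)
  have B_sets: "B l \<in> sets pspace" for l
    using measurable_sets[OF measurable_shift_by sets_R, of "int (q * l)" h] by (simp add: B_def vimage_def)
  have U_sets: "U \<in> sets pspace"
  proof -
    have "Measurable.pred pspace (\<lambda>\<omega>. \<forall>j<(L k)\<^sup>2. \<not> hit k (int j) \<omega>)" by measurable
    then show ?thesis by (simp add: U_def pred_def)
  qed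
  have A_sets [measurable]: "A \<in> sets pspace" unfolding A_def
    using B_sets U_sets by (intro sets.Diff sets.top sets.Un sets.finite_UN) auto
  have "P.prob (\<Union>l\<in>{..8 * K}. B l) \<le> (\<Sum>l\<in>{..8 * K}. P.prob (B l))"
    using B_sets by (intro P.finite_measure_subadditive_finite) auto
  also have "\<dots> \<le> (\<Sum>l\<in>{..8 * K}. 16 / real (L k))"
  proof (rule sum_mono)
    fix l
    have "P.prob (B l) = P.prob {\<omega>. R h \<omega>}" unfolding B_def by (rule prob_shift_by[OF sets_R])
    also have "\<dots> \<le> 4 / (real h + 1)" by (rule prob_R)
    also have "\<dots> \<le> 4 / (real (L k) / 4)"
    proof (intro divide_left_mono)
      show "real (L k) / 4 \<le> real h + 1" unfolding h_def by linarith
    qed (use L_pos[of k] in auto)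
    finally show "P.prob (B l) \<le> 16 / real (L k)" by simp
  qed
  also have "\<dots> = (8 * real K + 1) * 16 / real (L k)" by simp
  also have "\<dots> \<le> 1 / 4"
  proof -
    have "64 * (8 * K + 1) \<le> L k" using kL by (simp add: k_def)
    then have "real (64 * (8 * K + 1)) \<le> real (L k)" by (rule of_nat_mono)
    then show ?thesis using L_pos[of k] by (simp add: field_simps)
  qed
  finally have B_le: "P.prob (\<Union>l\<in>{..8 * K}. B l) \<le> 1 / 4" .
  have "P.prob (U \<union> (\<Union>l\<in>{..8 * K}. B l)) \<le> P.prob U + P.prob (\<Union>l\<in>{..8 * K}. B l)"
    using U_sets B_sets by (intro measure_Un_le) auto
  moreover have "P.prob U \<le> 1 / 2" unfolding U_def by (rule prob_no_hit_le)
  moreover have "P.prob A = 1 - P.prob (U \<union> (\<Union>l\<in>{..8 * K}. B l))"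
    unfolding A_def using U_sets B_sets by (intro P.prob_compl) auto
  ultimately have A_ge: "1 / 4 \<le> P.prob A" using B_le by linarith
  let ?h = "\<lambda>\<omega>. trunc_osc (real K) (fpath b n \<omega>)"
  have h_meas: "?h \<in> borel_measurable pspace" by (rule measurable_trunc_osc_fpath[OF b]) simp
  have h_bounds: "0 \<le> ?h \<omega>" "?h \<omega> \<le> 1" for \<omega>
    unfolding fpath_def by (rule trunc_osc_bounds[OF bounded_gpath[OF b]], simp)+
  have h_int: "integrable pspace ?h"
    by (rule P.integrable_const_bound[OF _ h_meas, of 1]) (use h_bounds in auto)
  have "P.prob A / 2 = (\<integral>\<omega>. indicator A \<omega> / 2 \<partial>pspace)" by simp
  also have "\<dots> \<le> (\<integral>\<omega>. ?h \<omega> + ?h (flip \<omega>) \<partial>pspace)"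
  proof (rule integral_mono)
    fix \<omega>
    show "indicator A \<omega> / 2 \<le> ?h \<omega> + ?h (flip \<omega>)"
    proof (cases "\<omega> \<in> A")
      case True
      then obtain j where j: "j < n" "hit k (int j) \<omega>" by (auto simp: A_def U_def n_def)
      have "\<not> R h (shift_by (int (q * l)) \<omega>)" if "l \<le> 8 * K" for l
        using True that by (auto simp: A_def B_def)
      from trunc_osc_fpath_flip[OF b K n_def nK q_def j this[unfolded h_def]] True
      show ?thesis by simp
    qed (use h_bounds in simp)
  qed (use h_int integrable_flip[OF h_int] in \<open>auto simp: P.emeasure_eq_measure\<close>)
  also have "\<dots> = 2 * (\<integral>\<omega>. ?h \<omega> \<partial>pspace)"
    using h_int integrable_flip[OF h_int] integral_flip[OF h_meas] by simp
  finally have "1 / 16 \<le> (\<integral>\<omega>. ?h \<omega> \<partial>pspace)" using A_ge by linarith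
  then show "\<exists>n\<ge>N. 1 / 16 \<le> (\<integral>\<omega>. trunc_osc (real K) (fpath b n \<omega>) \<partial>pspace)"
    using nN by blast
qed

lemma not_wip:
  "\<not> wip_C_holds pspace shift f (\<lambda>n. sqrt (real n))"
  "\<not> wip_D_holds pspace shift f (\<lambda>n. sqrt (real n))"
proof -
  have I: "interpolated_path shift f (\<lambda>n. sqrt (real n)) = fpath 1"
    by (intro ext) (simp add: interpolated_path_eq_gpath fpath_def shift_funpow)
  have S: "step_path shift f (\<lambda>n. sqrt (real n)) = fpath 0"
    by (intro ext) (simp add: step_path_eq_gpath fpath_def shift_funpow)
  show "\<not> wip_C_holds pspace shift f (\<lambda>n. sqrt (real n))"
    unfolding wip_C_holds_def I
    by (rule path_metric.not_converges_weakly[OF path_metric_C01, of "1 / 16"])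
      (rule trunc_osc_fpath_frequently, simp_all)
  show "\<not> wip_D_holds pspace shift f (\<lambda>n. sqrt (real n))"
    unfolding wip_D_holds_def S
    by (rule path_metric.not_converges_weakly[OF path_metric_D01, of "1 / 16"])
      (rule trunc_osc_fpath_frequently, simp_all)
qed

end

section \<open>Choice of the scales and conclusion\<close>

text \<open>The demand on \<open>L (Suc k)\<close> involves \<open>c\<close> only at the index
  \<open>2 * L k + 2\<close>, which is already fixed, so the scales can be chosen recursively as the
  larger of the doubling and the mixing requirement.\<close>

lemma tents_exists:
  fixes c :: "nat \<Rightarrow> real"
  assumes "\<And>j. c j > 0"
  shows "\<exists>L. tents L \<and> (\<forall>k. 12 / real (L (Suc k)) \<le> c (2 * L k + 2))"
proof -
  define L :: "nat \<Rightarrow> nat" where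
    "L = rec_nat 1 (\<lambda>_ l. max (2 * l) (nat \<lceil>12 / c (2 * l + 2)\<rceil>))"
  have L_Suc: "L (Suc k) = max (2 * L k) (nat \<lceil>12 / c (2 * L k + 2)\<rceil>)" for k
    by (simp add: L_def)
  have pos: "0 < L k" for k
  proof (induction k)
    case (Suc k)
    then show ?case by (simp add: L_Suc)
  qed (simp add: L_def)
  have "12 / real (L (Suc k)) \<le> c (2 * L k + 2)" for k
  proof -
    have "12 / c (2 * L k + 2) \<le> real (nat \<lceil>12 / c (2 * L k + 2)\<rceil>)" by linarith
    also have "\<dots> \<le> real (L (Suc k))" by (simp add: L_Suc)
    finally show ?thesis using pos[of "Suc k"] assms[of "2 * L k + 2"] by (simp add: field_simps)
  qed
  moreover have "tents L" by standard (use pos in \<open>auto simp: L_Suc\<close>)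
  ultimately show ?thesis by blast
qed

theorem theoremA:
  fixes c :: "nat \<Rightarrow> real"
  assumes "decseq c" and "\<And>j. c j > 0"
  shows "\<exists>(M :: (nat \<times> int \<Rightarrow> real) measure) T f.
    prob_space M \<and> invertible_mpt M T \<and> zero_mean_square_integrable M f \<and>
    clt_holds M T f (\<lambda>n. sqrt (real n)) \<and>
    \<not> wip_C_holds M T f (\<lambda>n. sqrt (real n)) \<and>
    \<not> wip_D_holds M T f (\<lambda>n. sqrt (real n)) \<and>
    asymp_equal (psum_variance M T f) (\<lambda>N. real N) \<and>
    (\<exists>m :: nat \<Rightarrow> nat. strict_mono_on {1..} m \<and>
       (\<forall>k\<ge>1. beta_mixing M (stationary_process M T f) (m k) \<le> c (m k))) \<and>
    (\<forall>p>0. integrable M (\<lambda>\<omega>. \<bar>stationary_process M T f 0 \<omega>\<bar> powr p))"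
proof -
  obtain L where L: "tents L" "\<And>k. 12 / real (L (Suc k)) \<le> c (2 * L k + 2)"
    using tents_exists[of c] assms(2) by blast
  interpret tents L by (rule L(1))
  \<comment> \<open>The times \<open>m k\<close> are the gap lengths of
    \<open>beta_mixing_f\<close>.\<close>
  have "strict_mono_on {1..} (\<lambda>k. 2 * L k + 2)"
    using L_strict by (auto simp: strict_mono_on_def strict_mono_def)
  moreover have "beta_mixing pspace (stationary_process pspace shift f) (2 * L k + 2) \<le> c (2 * L k + 2)" for k
    using beta_mixing_f L(2) by (rule order_trans)
  ultimately have "\<exists>m :: nat \<Rightarrow> nat. strict_mono_on {1..} m \<and>
      (\<forall>k\<ge>1. beta_mixing pspace (stationary_process pspace shift f) (m k) \<le> c (m k))"
    by (intro exI[of _ "\<lambda>k. 2 * L k + 2"]) auto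
  then show ?thesis
    using P.prob_space_axioms invertible_shift f_zero_mean clt_f not_wip variance_asymp f_moments
    by (intro exI[of _ pspace] exI[of _ shift] exI[of _ f]) (simp add: stationary_process_shift)
qed

end
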